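(* Let $\nu\in\{3,4\}$ and consider the Adams--Bashforth method AB$\nu$. Assume the inverse inequality $\|GV_h\|_\Omega\le C_Gh^{-1}\|V_h\|_\Omega$ for all $V_h\in\mathcal V_h$ and $$0<\delta\le C_\delta h,\qquad \tau\le c_{\mathrm{AB}}C_G^{-1}h,$$ with $c_{\mathrm{AB}}>0$ sufficiently small. Let $V_h^n\in\mathcal V_h$, $0\le n\le N$, solve $$(A_\tau V_h^n,T_\delta W)_\Omega=(R^n,T_\delta W)_\Omega\qquad\forall W\in\mathcal V_h,\ \nu\le n\le N,$$ with $R^n\in\mathcal H$. Then $$\|V_h\|_{\mathcal E_{\mathrm{AB}\nu},N}^2\lesssim\mathcal I_\tau(V_h)+\|R\|_{\mathcal E_{\mathrm{AB}\nu}^*,N}^2+\tau\|R\|_{\ell_\tau^2(\nu,N;\mathcal H)}^2 .$$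
   Context: Setting. $\mathcal H$ is a real Hilbert space (in the application $[L^2(\Omega)]^{n_{\rm sys}}$) with inner product $(\cdot,\cdot)_\Omega$ and norm $\|\cdot\|_\Omega$; $\mathcal V\subset\mathcal H$ is dense; $G:\mathcal V\to\mathcal H$ is linear, time independent, with $(GU,V)_\Omega=-(U,GV)_\Omega$ for all $U,V\in\mathcal V$; $\mathcal V_h\subset\mathcal V$ is a finite-dimensional (conforming finite element) subspace with mesh size $h$. $\tau>0$, $t^n=n\tau$ ($0\le n\le N$), $t^N\le T$, $\delta>0$. AB$\nu$: $D_\tau^-V^n=\tau^{-1}(V^n-V^{n-1})$ and $\mathcal M_\tau V^n=\mathcal M_{\mathrm{AB}\nu}V^n=\sum_{j=0}^{\nu}b_jV^{n-j}$ with AB3: $(b_0,\dots,b_3)=(0,\frac{23}{12},-\frac{16}{12},\frac5{12})$; AB4: $(b_0,\dots,b_4)=(0,\frac{55}{24},-\frac{59}{24},\frac{37}{24},-\frac9{24})$. The first computed index is $n_0=\nu$; $N\ge\nu$. Increments: $d^1V^n=V^n-V^{n-1}$, $d^jV^n=d^{j-1}V^n-d^{j-1}V^{n-1}$. Operators: $T_\delta=\mathrm{Id}+\delta G$, $S_\delta=\mathcal M_\tau+\delta D_\tau^-$, $A_\tau=D_\tau^-+G\mathcal M_\tau$, $P_\delta=T_\delta S_\delta$. Graph norm $\|V\|_\delta^2=\|V\|_\Omega^2+\delta^2\|GV\|_\Omega^2=\|T_\delta V\|_\Omega^2$. Norms. $\mathcal I_\tau(V)=\sum_{j=0}^{\nu-1}\|T_\delta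 V^j\|_\Omega^2$; $\|R\|_{\ell_\tau^2(a,b;\mathcal H)}^2=\tau\sum_{n=a}^b\|R^n\|_\Omega^2$; for $\nu\le m\le N$, $$\|V\|_{\mathcal E_{\mathrm{AB}\nu},m}^2=\max_{\nu\le n\le m}\|T_\delta V^n\|_\Omega^2+\tau\delta\sum_{n=\nu}^m\|A_\tau V^n\|_\Omega^2+\sum_{n=\nu}^{m-1}\|d^{\nu-1}V^n\|_\delta^2,$$ $$\|R\|_{\mathcal E_{\mathrm{AB}\nu}^*,N}=\max_{\nu\le m\le N}\ \sup_V\ \frac{\tau\sum_{n=\nu}^m(R^n,P_\delta V^n)_\Omega}{\bigl(\mathcal I_\tau(V)+\|V\|_{\mathcal E_{\mathrm{AB}\nu},m}^2\bigr)^{1/2}},$$ the supremum being over $\mathcal V_h$-valued sequences with $V^n=0$ for $n\notin\{0,\dots,m\}$ and positive denominator. Conventions: $a\lesssim b$ means $a\le Cb$ with $C>0$ independent of $h$, $\tau$, $N$ and of the sequences; "$c_{\mathrm{AB}}$ sufficiently small" means below a positive threshold independent of $h$, $\tau$, $N$. *)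

theory Defs
  imports "HOL-Analysis.Analysis"
begin

text \<open>
  Sequences are functions \<open>nat \<Rightarrow> 'a\<close>. Below, an increment or a backward shift at index \<open>n\<close> only
  has its intended value if the indices it reaches back to are nonnegative (natural number
  subtraction truncates). All norms and the scheme evaluate \<open>D_tau\<close>, \<open>M_AB\<close> and \<open>incr (\<nu> - 1)\<close>
  at \<open>n \<ge> \<nu>\<close> only, where no truncation occurs.
\<close>

text \<open>The list \<open>(b_0, ..., b_\<nu>)\<close>; only the values at \<open>\<nu> = 3\<close> and \<open>\<nu> = 4\<close> are meaningful.\<close>
definition ab_coeffs :: "nat \<Rightarrow> real list" where
  "ab_coeffs \<nu> =
     (if \<nu> = 3 then [0, 23/12, - (16/12), 5/12]
      else if \<nu> = 4 then [0, 55/24, - (59/24), 37/24, - (9/24)]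
      else undefined)"

definition M_AB :: "nat \<Rightarrow> (nat \<Rightarrow> 'a::real_vector) \<Rightarrow> nat \<Rightarrow> 'a" where
  "M_AB \<nu> V n = (\<Sum>j=0..\<nu>. (ab_coeffs \<nu> ! j) *\<^sub>R V (n - j))"

definition D_tau :: "real \<Rightarrow> (nat \<Rightarrow> 'a::real_vector) \<Rightarrow> nat \<Rightarrow> 'a" where
  "D_tau \<tau> V n = (1 / \<tau>) *\<^sub>R (V n - V (n - 1))"

primrec incr :: "nat \<Rightarrow> (nat \<Rightarrow> 'a::real_vector) \<Rightarrow> nat \<Rightarrow> 'a" where
  "incr 0 V = V"
| "incr (Suc j) V = (\<lambda>n. incr j V n - incr j V (n - 1))"

definition T_op :: "real \<Rightarrow> ('a \<Rightarrow> 'a) \<Rightarrow> 'a::real_vector \<Rightarrow> 'a" where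
  "T_op \<delta> G U = U + \<delta> *\<^sub>R G U"

definition S_op :: "nat \<Rightarrow> real \<Rightarrow> real \<Rightarrow> (nat \<Rightarrow> 'a::real_vector) \<Rightarrow> nat \<Rightarrow> 'a" where
  "S_op \<nu> \<delta> \<tau> V n = M_AB \<nu> V n + \<delta> *\<^sub>R D_tau \<tau> V n"

definition A_op :: "nat \<Rightarrow> real \<Rightarrow> ('a \<Rightarrow> 'a) \<Rightarrow> (nat \<Rightarrow> 'a::real_vector) \<Rightarrow> nat \<Rightarrow> 'a" where
  "A_op \<nu> \<tau> G V n = D_tau \<tau> V n + G (M_AB \<nu> V n)"

definition P_op :: "nat \<Rightarrow> real \<Rightarrow> real \<Rightarrow> ('a \<Rightarrow> 'a) \<Rightarrow> (nat \<Rightarrow> 'a::real_vector) \<Rightarrow> nat \<Rightarrow> 'a" where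
  "P_op \<nu> \<delta> \<tau> G V n = T_op \<delta> G (S_op \<nu> \<delta> \<tau> V n)"

definition graph_norm :: "real \<Rightarrow> ('a \<Rightarrow> 'a) \<Rightarrow> 'a::real_normed_vector \<Rightarrow> real" where
  "graph_norm \<delta> G U = sqrt ((norm U)\<^sup>2 + \<delta>\<^sup>2 * (norm (G U))\<^sup>2)"

definition I_tau :: "nat \<Rightarrow> real \<Rightarrow> ('a \<Rightarrow> 'a) \<Rightarrow> (nat \<Rightarrow> 'a::real_normed_vector) \<Rightarrow> real" where
  "I_tau \<nu> \<delta> G V = (\<Sum>j=0..\<nu> - 1. (norm (T_op \<delta> G (V j)))\<^sup>2)"

definition l2_norm :: "real \<Rightarrow> nat \<Rightarrow> nat \<Rightarrow> (nat \<Rightarrow> 'a::real_normed_vector) \<Rightarrow> real" where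
  "l2_norm \<tau> a b R = sqrt (\<tau> * (\<Sum>n=a..b. (norm (R n))\<^sup>2))"

definition E_norm ::
  "nat \<Rightarrow> real \<Rightarrow> real \<Rightarrow> ('a \<Rightarrow> 'a) \<Rightarrow> nat \<Rightarrow> (nat \<Rightarrow> 'a::real_normed_vector) \<Rightarrow> real" where
  "E_norm \<nu> \<delta> \<tau> G m V =
     sqrt ((MAX n\<in>{\<nu>..m}. (norm (T_op \<delta> G (V n)))\<^sup>2)
           + \<tau> * \<delta> * (\<Sum>n=\<nu>..m. (norm (A_op \<nu> \<tau> G V n))\<^sup>2)
           + (\<Sum>n=\<nu>..<m. (graph_norm \<delta> G (incr (\<nu> - 1) V n))\<^sup>2))"

text \<open>
  The supremum is taken in the reals. Its argument is bounded above whenever \<open>Vh\<close> is a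
  finite-dimensional subspace on which \<open>G\<close> is linear and skew-symmetric and \<open>\<delta>, \<tau> \<ge> 0\<close>, since the denominator then
  dominates \<open>norm (T_op \<delta> G (V n))\<close> for every \<open>n \<le> m\<close>. It is empty only for the zero space \<open>Vh\<close>.
\<close>
definition E_dual_norm ::
  "nat \<Rightarrow> real \<Rightarrow> real \<Rightarrow> ('a \<Rightarrow> 'a) \<Rightarrow> 'a set \<Rightarrow> nat \<Rightarrow> (nat \<Rightarrow> 'a::real_inner) \<Rightarrow> real" where
  "E_dual_norm \<nu> \<delta> \<tau> G Vh N R =
     (MAX m\<in>{\<nu>..N}.
        SUP V \<in> {V. (\<forall>n. V n \<in> Vh) \<and> (\<forall>n. n \<notin> {0..m} \<longrightarrow> V n = 0) \<and>
                    0 < sqrt (I_tau \<nu> \<delta> G V + (E_norm \<nu> \<delta> \<tau> G m V)\<^sup>2)}.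
          (\<tau> * (\<Sum>n=\<nu>..m. R n \<bullet> P_op \<nu> \<delta> \<tau> G V n))
            / sqrt (I_tau \<nu> \<delta> G V + (E_norm \<nu> \<delta> \<tau> G m V)\<^sup>2))"

end

theory Submission
  imports Defs
begin

text \<open>
  Put \<open>X\<^sup>n = T\<^sub>\<delta> V\<^sup>n\<close>. Since \<open>G\<close> is skew-symmetric, \<open>\<parallel>T\<^sub>\<delta> U\<parallel>\<close> is the graph norm of \<open>U\<close>, and testing the
  scheme with \<open>S\<^sub>\<delta> V\<^sup>n\<close> gives the exact balance (\<open>A_inner_P\<close>)
  \<open>\<tau> (R\<^sup>n, P\<^sub>\<delta> V\<^sup>n) = (X\<^sup>n - X\<^sup>n\<^sup>-\<^sup>1, M X\<^sup>n) + \<tau> \<delta> \<parallel>A\<^sub>\<tau> V\<^sup>n\<parallel>\<^sup>2\<close>.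
  All that the spatial operator still contributes is a bound for small increments; the rest is about a
  sequence \<open>X\<close> in an inner product space.

  The first term on the right is the energy production of the multistep formula. With
  \<open>z = exp (i \<theta>)\<close> and \<open>s = \<bar>1 - z\<bar>\<^sup>2\<close>, the real part of the symbol of \<open>(X\<^sup>n - X\<^sup>n\<^sup>-\<^sup>1, M X\<^sup>n)\<close> is
  \<open>3/8 s\<^sup>2 - 5/24 s\<^sup>3\<close> for AB3 and \<open>13/24 s\<^sup>3 - 3/16 s\<^sup>4\<close> for AB4. Up to a telescoping term the production
  is therefore a positive multiple of \<open>\<parallel>d\<^sup>\<nu>\<^sup>-\<^sup>1 X\<^sup>n\<^sup>-\<^sup>1\<parallel>\<^sup>2\<close> minus a multiple of \<open>\<parallel>d\<^sup>\<nu> X\<^sup>n\<parallel>\<^sup>2\<close>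
  (\<open>AB3_energy_identity\<close>, \<open>AB4_energy_identity\<close>, \<open>AB_energy_bound\<close>). The sign of the leading coefficient
  is what makes the methods dissipative on the imaginary axis near the origin.

  The negative term is absorbed by the step size restriction. Testing the \<open>k\<close>-th difference of the
  scheme with \<open>d\<^sup>k D\<^sub>\<tau> V\<^sup>n\<close> and using the inverse inequality yields (\<open>incr_T_norm_le\<close>)
  \<open>\<parallel>d\<^sup>k\<^sup>+\<^sup>1 X\<^sup>n\<parallel> \<le> K\<^sup>2 (c \<parallel>M d\<^sup>k X\<^sup>n\<parallel> + \<tau> \<parallel>d\<^sup>k R\<^sup>n\<parallel>)\<close>. With \<open>k = \<nu> - 1\<close> this bounds the negative term by a
  small multiple of the positive one and by \<open>\<tau>\<^sup>2 \<Sum> \<parallel>R\<^sup>n\<parallel>\<^sup>2\<close>, which is the last term of the claim. With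
  \<open>k = 0\<close> it bounds the correction of \<open>\<parallel>X\<^sup>n\<parallel>\<^sup>2 / 2\<close> in the telescoping energy, which is a quadratic form in
  first increments, as well as \<open>d\<^sup>\<nu> X\<^sup>n\<close> at the first few indices, where the differences of the scheme are
  not available. This is \<open>AB_coercivity\<close>. The pairing with \<open>R\<close> is at most the dual norm times the norm of
  \<open>V\<close> (\<open>sum_inner_P_le_dual\<close>), and Young's inequality finishes the proof (\<open>AB_stability\<close>).
\<close>

section \<open>Backward differences\<close>

lemma incr_diff: "incr k (\<lambda>n. V n - W n) n = incr k V n - incr k W n"
  by (induction k arbitrary: n) auto

lemma incr_add: "incr k (\<lambda>n. V n + W n) n = incr k V n + incr k W n"
  by (induction k arbitrary: n) auto

lemma incr_scaleR: "incr k (\<lambda>n. c *\<^sub>R V n) n = c *\<^sub>R incr k V n"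
  by (induction k arbitrary: n) (auto simp: scaleR_diff_right)

lemma incr_Suc_right: "incr (Suc k) V = incr k (incr (Suc 0) V)"
  by (induction k) (auto simp: fun_eq_iff)

lemma incr_M_AB: "incr k (M_AB \<nu> V) n = M_AB \<nu> (incr k V) n"
proof (induction k arbitrary: n)
  case (Suc k)
  then show ?case
    by (simp add: M_AB_def scaleR_diff_right sum_subtractf diff_commute)
qed simp

lemma incr_D_tau: "\<tau> \<noteq> 0 \<Longrightarrow> \<tau> *\<^sub>R incr k (D_tau \<tau> V) n = incr (Suc k) V n"
proof (induction k arbitrary: n)
  case 0
  then show ?case by (simp add: D_tau_def)
next
  case (Suc k)
  then show ?case by (simp add: scaleR_diff_right)
qed

lemma incr_orthogonal:
  fixes f :: "nat \<Rightarrow> 'a::real_inner"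
  assumes "\<And>n. a \<le> n \<Longrightarrow> n \<le> b \<Longrightarrow> f n \<bullet> w = 0"
  shows "a + k \<le> n \<Longrightarrow> n \<le> b \<Longrightarrow> incr k f n \<bullet> w = 0"
proof (induction k arbitrary: n)
  case (Suc k)
  have "incr k f n \<bullet> w = 0" "incr k f (n - 1) \<bullet> w = 0"
    using Suc by simp_all
  then show ?case by (simp add: inner_diff_left)
qed (use assms in simp)

lemma incr_cong:
  assumes "\<And>i. i \<le> n \<Longrightarrow> V i = W i"
  shows "incr k V n = incr k W n"
  using assms
proof (induction k arbitrary: n)
  case (Suc k)
  have "incr k V n = incr k W n" "incr k V (n - 1) = incr k W (n - 1)"
    using Suc by simp_all
  then show ?case by simp
qed simp

lemma power2_norm_diff_le:
  fixes x y :: "'a::real_inner"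
  shows "(norm (x - y))\<^sup>2 \<le> 2 * (norm x)\<^sup>2 + 2 * (norm y)\<^sup>2"
proof -
  have "(norm (x - y))\<^sup>2 + (norm (x + y))\<^sup>2 = 2 * (norm x)\<^sup>2 + 2 * (norm y)\<^sup>2"
    by (simp add: power2_norm_eq_inner inner_simps inner_commute)
  then show ?thesis
    using zero_le_power2[of "norm (x + y)"] by linarith
qed

lemma incr_norm_le:
  fixes X :: "nat \<Rightarrow> 'a::real_inner"
  shows "(norm (incr k X n))\<^sup>2 \<le> 4 ^ k * (\<Sum>i\<le>k. (norm (X (n - i)))\<^sup>2)"
proof (induction k arbitrary: n)
  case (Suc k)
  let ?f = "\<lambda>i. (norm (X (n - i)))\<^sup>2"
  have 1: "(\<Sum>i\<le>k. ?f i) \<le> (\<Sum>i\<le>Suc k. ?f i)"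
    by simp
  have 2: "(\<Sum>i\<le>k. ?f (Suc i)) \<le> (\<Sum>i\<le>Suc k. ?f i)"
    unfolding sum.atMost_Suc_shift by simp
  have "(norm (incr (Suc k) X n))\<^sup>2
      \<le> 2 * (norm (incr k X n))\<^sup>2 + 2 * (norm (incr k X (n - 1)))\<^sup>2"
    using power2_norm_diff_le by simp
  also have "\<dots> \<le> 2 * (4 ^ k * (\<Sum>i\<le>k. ?f i)) + 2 * (4 ^ k * (\<Sum>i\<le>k. ?f (Suc i)))"
    using Suc[of n] Suc[of "n - 1"] by simp
  also have "\<dots> \<le> 2 * (4 ^ k * (\<Sum>i\<le>Suc k. ?f i)) + 2 * (4 ^ k * (\<Sum>i\<le>Suc k. ?f i))"
    using 1 2 by (intro add_mono mult_left_mono) auto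
  finally show ?case by simp
qed simp

lemma sum_shifts_le:
  fixes f :: "nat \<Rightarrow> real"
  assumes "\<And>n. f n \<ge> 0" and "finite S" and "\<And>i. i \<in> S \<Longrightarrow> l + i \<le> a" and "\<And>i. i \<in> S \<Longrightarrow> b \<le> u + i"
  shows "(\<Sum>n=a..b. \<Sum>i\<in>S. f (n - i)) \<le> card S * (\<Sum>n=l..u. f n)"
proof -
  have "(\<Sum>n=a..b. f (n - i)) \<le> (\<Sum>n=l..u. f n)" if "i \<in> S" for i
  proof -
    have "(\<Sum>n=a..b. f (n - i)) = sum f ((\<lambda>n. n - i) ` {a..b})"
      using assms(3)[OF that] by (subst sum.reindex) (auto simp: inj_on_def)
    also have "\<dots> \<le> (\<Sum>n=l..u. f n)"
      using assms(1) assms(3,4)[OF that] by (intro sum_mono2) force+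
    finally show ?thesis .
  qed
  then have "(\<Sum>i\<in>S. \<Sum>n=a..b. f (n - i)) \<le> (\<Sum>i\<in>S. \<Sum>n=l..u. f n)"
    by (rule sum_mono)
  then show ?thesis by (subst sum.swap) simp
qed

section \<open>The Adams-Bashforth average\<close>

lemma ab_coeffs_0: "\<nu> \<in> {3, 4} \<Longrightarrow> ab_coeffs \<nu> ! 0 = 0"
  by (auto simp: ab_coeffs_def)

lemma ab_coeffs_abs_le: "\<nu> \<in> {3, 4} \<Longrightarrow> j \<le> \<nu> \<Longrightarrow> \<bar>ab_coeffs \<nu> ! j\<bar> \<le> 3"
proof -
  assume "\<nu> \<in> {3, 4}" "j \<le> \<nu>"
  then have "j \<in> {0, 1, 2, 3, 4}" by auto
  with \<open>\<nu> \<in> {3, 4}\<close> \<open>j \<le> \<nu>\<close> show ?thesis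
    by (auto simp: ab_coeffs_def)
qed

lemma M_AB_norm_le:
  fixes X :: "nat \<Rightarrow> 'a::real_normed_vector"
  assumes "\<nu> \<in> {3, 4}"
  shows "norm (M_AB \<nu> X n) \<le> 3 * (\<Sum>j=1..\<nu>. norm (X (n - j)))"
proof -
  have "M_AB \<nu> X n = (\<Sum>j=1..\<nu>. (ab_coeffs \<nu> ! j) *\<^sub>R X (n - j))"
    unfolding M_AB_def using ab_coeffs_0[OF assms]
    by (subst sum.atLeast_Suc_atMost) auto
  then have "norm (M_AB \<nu> X n) \<le> (\<Sum>j=1..\<nu>. norm ((ab_coeffs \<nu> ! j) *\<^sub>R X (n - j)))"
    using norm_sum by metis
  also have "\<dots> \<le> (\<Sum>j=1..\<nu>. 3 * norm (X (n - j)))"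
    using ab_coeffs_abs_le[OF assms] by (intro sum_mono) (auto intro: mult_right_mono)
  finally show ?thesis by (simp add: sum_distrib_left)
qed

lemma M_AB_power2_norm_le:
  fixes X :: "nat \<Rightarrow> 'a::real_normed_vector"
  assumes "\<nu> \<in> {3, 4}"
  shows "(norm (M_AB \<nu> X n))\<^sup>2 \<le> 36 * (\<Sum>j=1..\<nu>. (norm (X (n - j)))\<^sup>2)"
proof -
  have "(norm (M_AB \<nu> X n))\<^sup>2 \<le> 9 * (\<Sum>j=1..\<nu>. norm (X (n - j)))\<^sup>2"
    using power_mono[OF M_AB_norm_le[OF assms, of X n] norm_ge_zero, of 2]
    by (simp add: power_mult_distrib)
  also have "(\<Sum>j=1..\<nu>. norm (X (n - j)))\<^sup>2 \<le> \<nu> * (\<Sum>j=1..\<nu>. (norm (X (n - j)))\<^sup>2)"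
    using sum_squared_le_sum_of_squares[of "\<lambda>j. norm (X (n - j))" "{1..\<nu>}"] by (simp add: mult.commute)
  also have "\<dots> \<le> 4 * (\<Sum>j=1..\<nu>. (norm (X (n - j)))\<^sup>2)"
    using assms by (intro mult_right_mono sum_nonneg) auto
  finally show ?thesis by simp
qed

text \<open>
  The coefficients of the two squared differences are those of the symbol
  \<open>3/8 s\<^sup>2 - 5/24 s\<^sup>3\<close> of the left-hand side, and \<open>Q\<close> is then determined by comparing coefficients. No
  product of \<open>x0\<close> with an increment occurs in the energy, so its deviation from \<open>\<parallel>x0\<parallel>\<^sup>2 / 2\<close> is
  controlled by increments alone.
\<close>

lemma AB3_energy_identity:
  fixes x0 :: "'a::real_inner"
  defines "Q \<equiv> \<lambda>d e :: 'a. 1/6 * (norm e)\<^sup>2 + 1/12 * (d \<bullet> e) - 7/24 * (norm d)\<^sup>2"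
  shows "(x0 - x1) \<bullet> ((23/12) *\<^sub>R x1 - (16/12) *\<^sub>R x2 + (5/12) *\<^sub>R x3)
    = (1/2 * (norm x0)\<^sup>2 + Q (x0 - x1) (x1 - x2)) - (1/2 * (norm x1)\<^sup>2 + Q (x1 - x2) (x2 - x3))
      + 3/8 * (norm (x1 - x2 - (x2 - x3)))\<^sup>2
      - 5/24 * (norm (x0 - x1 - (x1 - x2) - (x1 - x2 - (x2 - x3))))\<^sup>2"
  unfolding Q_def
  by (simp add: power2_norm_eq_inner inner_simps algebra_simps inner_commute
      add_divide_distrib diff_divide_distrib)

text \<open>The same for the symbol \<open>13/24 s\<^sup>3 - 3/16 s\<^sup>4\<close>.\<close>

lemma AB4_energy_identity:
  fixes x0 :: "'a::real_inner"
  defines "Q \<equiv> \<lambda>d e f :: 'a. 5/6 * (norm e)\<^sup>2 + 17/48 * (norm f)\<^sup>2 - 5/16 * (norm d)\<^sup>2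
      + 1/6 * (d \<bullet> e) - 1/24 * (d \<bullet> f) - 25/24 * (e \<bullet> f)"
  shows "(x0 - x1) \<bullet> ((55/24) *\<^sub>R x1 - (59/24) *\<^sub>R x2 + (37/24) *\<^sub>R x3 - (9/24) *\<^sub>R x4)
    = (1/2 * (norm x0)\<^sup>2 + Q (x0 - x1) (x1 - x2) (x2 - x3))
      - (1/2 * (norm x1)\<^sup>2 + Q (x1 - x2) (x2 - x3) (x3 - x4))
      + 13/24 * (norm (x1 - 3 *\<^sub>R x2 + 3 *\<^sub>R x3 - x4))\<^sup>2
      - 3/16 * (norm (x0 - 4 *\<^sub>R x1 + 6 *\<^sub>R x2 - 4 *\<^sub>R x3 + x4))\<^sup>2"
  unfolding Q_def
  by (simp add: power2_norm_eq_inner inner_simps algebra_simps inner_commute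
      add_divide_distrib diff_divide_distrib)

lemma inner_abs_le_half: "\<bar>x \<bullet> y\<bar> \<le> 1/2 * (norm x)\<^sup>2 + 1/2 * (norm y)\<^sup>2"
  for x y :: "'a::real_inner"
proof -
  have "2 * (norm x * norm y) \<le> (norm x)\<^sup>2 + (norm y)\<^sup>2"
    using sum_squares_bound[of "norm x" "norm y"] by (simp add: mult.assoc)
  then show ?thesis using Cauchy_Schwarz_ineq2[of x y] by simp
qed

text \<open>
  The common form of the two identities: \<open>1/4\<close> lies below \<open>3/8\<close> and \<open>13/24\<close> and above \<open>5/24\<close> and
  \<open>3/16\<close>.
\<close>

lemma AB_energy_bound:
  fixes X :: "nat \<Rightarrow> 'a::real_inner"
  assumes "\<nu> \<in> {3, 4}"
  obtains \<Phi> :: "nat \<Rightarrow> real" where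
    "\<And>n. \<nu> \<le> n \<Longrightarrow>
      (1/2 * (norm (X n))\<^sup>2 + \<Phi> n) - (1/2 * (norm (X (n - 1)))\<^sup>2 + \<Phi> (n - 1))
        + 1/4 * (norm (incr (\<nu> - 1) X (n - 1)))\<^sup>2
      \<le> (X n - X (n - 1)) \<bullet> M_AB \<nu> X n + 1/4 * (norm (incr \<nu> X n))\<^sup>2"
    "\<And>n. \<bar>\<Phi> n\<bar> \<le> 2 * (\<Sum>i<\<nu> - 1. (norm (incr 1 X (n - i)))\<^sup>2)"
proof -
  define d where "d = incr 1 X"
  show thesis
  proof (cases "\<nu> = 3")
    case True
    define \<Phi> where "\<Phi> n = 1/6 * (norm (d (n - 1)))\<^sup>2 + 1/12 * (d n \<bullet> d (n - 1))
        - 7/24 * (norm (d n))\<^sup>2" for n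
    show thesis
    proof (rule that[of \<Phi>])
      fix n assume n: "\<nu> \<le> n"
      have M: "M_AB \<nu> X n = (23/12) *\<^sub>R X (n - 1) - (16/12) *\<^sub>R X (n - 2) + (5/12) *\<^sub>R X (n - 3)"
        using True by (simp add: M_AB_def ab_coeffs_def numeral_eq_Suc)
      have i2: "incr (\<nu> - 1) X (n - 1) = X (n - 1) - X (n - 2) - (X (n - 2) - X (n - 3))"
        using True by (simp add: numeral_eq_Suc)
      have i3: "incr \<nu> X n = X n - X (n - 1) - (X (n - 1) - X (n - 2))
          - (X (n - 1) - X (n - 2) - (X (n - 2) - X (n - 3)))"
        using True by (simp add: numeral_eq_Suc)
      have P: "\<Phi> n = 1/6 * (norm (X (n - 1) - X (n - 2)))\<^sup>2
            + 1/12 * ((X n - X (n - 1)) \<bullet> (X (n - 1) - X (n - 2))) - 7/24 * (norm (X n - X (n - 1)))\<^sup>2"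
          "\<Phi> (n - 1) = 1/6 * (norm (X (n - 2) - X (n - 3)))\<^sup>2
            + 1/12 * ((X (n - 1) - X (n - 2)) \<bullet> (X (n - 2) - X (n - 3)))
            - 7/24 * (norm (X (n - 1) - X (n - 2)))\<^sup>2"
        by (simp_all add: \<Phi>_def d_def numeral_eq_Suc)
      show "(1/2 * (norm (X n))\<^sup>2 + \<Phi> n) - (1/2 * (norm (X (n - 1)))\<^sup>2 + \<Phi> (n - 1))
          + 1/4 * (norm (incr (\<nu> - 1) X (n - 1)))\<^sup>2
        \<le> (X n - X (n - 1)) \<bullet> M_AB \<nu> X n + 1/4 * (norm (incr \<nu> X n))\<^sup>2"
        using AB3_energy_identity[of "X n" "X (n - 1)" "X (n - 2)" "X (n - 3)"]
          zero_le_power2[of "norm (incr (\<nu> - 1) X (n - 1))"]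
          zero_le_power2[of "norm (incr \<nu> X n)"]
        unfolding M P i2 i3 by linarith
    next
      fix n
      have "\<bar>\<Phi> n\<bar> \<le> 2 * ((norm (d n))\<^sup>2 + (norm (d (n - 1)))\<^sup>2)"
        using inner_abs_le_half[of "d n" "d (n - 1)"] zero_le_power2[of "norm (d n)"]
          zero_le_power2[of "norm (d (n - 1))"]
        unfolding \<Phi>_def abs_le_iff by argo
      then show "\<bar>\<Phi> n\<bar> \<le> 2 * (\<Sum>i<\<nu> - 1. (norm (incr 1 X (n - i)))\<^sup>2)"
        using True by (simp add: numeral_eq_Suc d_def)
    qed
  next
    case False
    then have nu: "\<nu> = 4" using assms by simp
    define \<Phi> where "\<Phi> n = 5/6 * (norm (d (n - 1)))\<^sup>2 + 17/48 * (norm (d (n - 2)))\<^sup>2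
        - 5/16 * (norm (d n))\<^sup>2 + 1/6 * (d n \<bullet> d (n - 1)) - 1/24 * (d n \<bullet> d (n - 2))
        - 25/24 * (d (n - 1) \<bullet> d (n - 2))" for n
    show thesis
    proof (rule that[of \<Phi>])
      fix n assume n: "\<nu> \<le> n"
      have M: "M_AB \<nu> X n = (55/24) *\<^sub>R X (n - 1) - (59/24) *\<^sub>R X (n - 2)
          + (37/24) *\<^sub>R X (n - 3) - (9/24) *\<^sub>R X (n - 4)"
        using nu by (simp add: M_AB_def ab_coeffs_def numeral_eq_Suc)
      have sc: "3 *\<^sub>R x = x + x + x" "4 *\<^sub>R x = x + x + x + x"
          "6 *\<^sub>R x = x + x + x + x + x + x" for x :: 'a
        using scaleR_add_left[of 1 2 x] scaleR_add_left[of 2 2 x] scaleR_add_left[of 2 4 x]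
        by (simp_all add: scaleR_2)
      have i3: "incr (\<nu> - 1) X (n - 1) = X (n - 1) - 3 *\<^sub>R X (n - 2) + 3 *\<^sub>R X (n - 3) - X (n - 4)"
        unfolding sc using nu by (simp add: numeral_eq_Suc)
      have i4: "incr \<nu> X n
          = X n - 4 *\<^sub>R X (n - 1) + 6 *\<^sub>R X (n - 2) - 4 *\<^sub>R X (n - 3) + X (n - 4)"
        unfolding sc using nu by (simp add: numeral_eq_Suc)
      have P: "\<Phi> n = 5/6 * (norm (X (n - 1) - X (n - 2)))\<^sup>2 + 17/48 * (norm (X (n - 2) - X (n - 3)))\<^sup>2
            - 5/16 * (norm (X n - X (n - 1)))\<^sup>2
            + 1/6 * ((X n - X (n - 1)) \<bullet> (X (n - 1) - X (n - 2)))
            - 1/24 * ((X n - X (n - 1)) \<bullet> (X (n - 2) - X (n - 3)))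
            - 25/24 * ((X (n - 1) - X (n - 2)) \<bullet> (X (n - 2) - X (n - 3)))"
          "\<Phi> (n - 1) = 5/6 * (norm (X (n - 2) - X (n - 3)))\<^sup>2 + 17/48 * (norm (X (n - 3) - X (n - 4)))\<^sup>2
            - 5/16 * (norm (X (n - 1) - X (n - 2)))\<^sup>2
            + 1/6 * ((X (n - 1) - X (n - 2)) \<bullet> (X (n - 2) - X (n - 3)))
            - 1/24 * ((X (n - 1) - X (n - 2)) \<bullet> (X (n - 3) - X (n - 4)))
            - 25/24 * ((X (n - 2) - X (n - 3)) \<bullet> (X (n - 3) - X (n - 4)))"
        by (simp_all add: \<Phi>_def d_def numeral_eq_Suc)
      show "(1/2 * (norm (X n))\<^sup>2 + \<Phi> n) - (1/2 * (norm (X (n - 1)))\<^sup>2 + \<Phi> (n - 1))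
          + 1/4 * (norm (incr (\<nu> - 1) X (n - 1)))\<^sup>2
        \<le> (X n - X (n - 1)) \<bullet> M_AB \<nu> X n + 1/4 * (norm (incr \<nu> X n))\<^sup>2"
        using AB4_energy_identity[of "X n" "X (n - 1)" "X (n - 2)" "X (n - 3)" "X (n - 4)"]
          zero_le_power2[of "norm (incr (\<nu> - 1) X (n - 1))"]
          zero_le_power2[of "norm (incr \<nu> X n)"]
        unfolding M P i3 i4 by linarith
    next
      fix n
      have "\<bar>\<Phi> n\<bar> \<le> 2 * ((norm (d n))\<^sup>2 + (norm (d (n - 1)))\<^sup>2 + (norm (d (n - 2)))\<^sup>2)"
        using inner_abs_le_half[of "d n" "d (n - 1)"] inner_abs_le_half[of "d n" "d (n - 2)"]
          inner_abs_le_half[of "d (n - 1)" "d (n - 2)"] zero_le_power2[of "norm (d n)"]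
          zero_le_power2[of "norm (d (n - 1))"] zero_le_power2[of "norm (d (n - 2))"]
        unfolding \<Phi>_def abs_le_iff by argo
      then show "\<bar>\<Phi> n\<bar> \<le> 2 * (\<Sum>i<\<nu> - 1. (norm (incr 1 X (n - i)))\<^sup>2)"
        using nu by (simp add: numeral_eq_Suc d_def)
    qed
  qed
qed

section \<open>Absorbing the highest differences\<close>

text \<open>
  Summed over \<open>n\<close>, the energy production controls \<open>\<parallel>X m\<parallel>\<^sup>2\<close> and the squared differences of order
  \<open>\<nu> - 1\<close>, up to data and a multiple of \<open>(L * c)\<^sup>2\<close> of these same quantities. The evolution
  equation enters through the hypothesis \<open>step\<close>: a difference of order \<open>k + 1\<close> is small compared with
  differences of order \<open>k\<close>. It starts at \<open>\<nu> + k\<close> because the \<open>k\<close>-th difference of the scheme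
  reaches back \<open>k\<close> indices.
\<close>

lemma AB_coercivity:
  fixes X R :: "nat \<Rightarrow> 'a::real_inner" and c L \<tau> M :: real
  assumes nu: "\<nu> \<in> {3, 4}"
    and L: "1 \<le> L" and c: "0 \<le> c" "L * c \<le> 1" and \<tau>: "0 \<le> \<tau>"
    and step: "\<And>k n. \<nu> + k \<le> n \<Longrightarrow> n \<le> N \<Longrightarrow>
      norm (incr (Suc k) X n) \<le> L * (c * norm (M_AB \<nu> (incr k X) n) + \<tau> * norm (incr k R n))"
    and M: "\<And>n. \<nu> \<le> n \<Longrightarrow> n \<le> N \<Longrightarrow> (norm (X n))\<^sup>2 \<le> M"
    and m: "\<nu> \<le> m" "m \<le> N"
  defines "I \<equiv> (\<Sum>j=0..\<nu> - 1. (norm (X j))\<^sup>2)"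
    and "J \<equiv> (\<Sum>n=\<nu>..<m. (norm (incr (\<nu> - 1) X n))\<^sup>2)"
    and "\<rho> \<equiv> \<tau>\<^sup>2 * (\<Sum>n=\<nu>..N. (norm (R n))\<^sup>2)"
  shows "1/2 * (norm (X m))\<^sup>2 + 1/4 * J
    \<le> (\<Sum>n=\<nu>..m. (X n - X (n - 1)) \<bullet> M_AB \<nu> X n) + 60000 * (L * c)\<^sup>2 * (M + J) + 80000 * L\<^sup>2 * (I + \<rho>)"
proof -
  define \<kappa> where "\<kappa> = (L * c)\<^sup>2"
  define g where "g n = (norm (incr (\<nu> - 1) X n))\<^sup>2" for n
  define a where "a n = (norm (incr \<nu> X n))\<^sup>2" for n
  define r where "r n = (norm (R n))\<^sup>2" for n
  define \<beta> where "\<beta> = 288 * \<kappa> * (M + I) + 2 * L\<^sup>2 * \<rho> + 4 * I"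
  have \<kappa>: "0 \<le> \<kappa>" "\<kappa> \<le> 1"
    using L c by (auto simp: \<kappa>_def power_le_one)
  have I0: "0 \<le> I" and J0: "0 \<le> J" and \<rho>0: "0 \<le> \<rho>"
    by (auto simp: I_def J_def \<rho>_def sum_nonneg)
  have M0: "0 \<le> M"
    using M[OF m] zero_le_power2 order_trans by blast
  have nu': "2 \<le> \<nu>" "\<nu> \<le> 4" using nu by auto
  have L2: "1 \<le> L\<^sup>2" using L by (simp add: one_le_power)
  have \<beta>0: "0 \<le> \<beta>"
    unfolding \<beta>_def using \<kappa> M0 I0 \<rho>0 by simp
  have XI: "(norm (X n))\<^sup>2 \<le> I" if "n < \<nu>" for n
    unfolding I_def using that nu' by (intro member_le_sum) auto
  have XMI: "(norm (X n))\<^sup>2 \<le> M + I" if "n \<le> N" for n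
    using XI[of n] M[of n] that I0 M0 by (cases "n < \<nu>") auto
  have step2: "(norm (incr (Suc k) X n))\<^sup>2
      \<le> 2 * \<kappa> * (norm (M_AB \<nu> (incr k X) n))\<^sup>2 + 2 * L\<^sup>2 * (\<tau>\<^sup>2 * (norm (incr k R n))\<^sup>2)"
    if "\<nu> + k \<le> n" "n \<le> N" for k n
  proof -
    define p where "p = L * c * norm (M_AB \<nu> (incr k X) n)"
    define q where "q = L * \<tau> * norm (incr k R n)"
    have "norm (incr (Suc k) X n) \<le> p + q"
      using step[OF that] by (simp add: p_def q_def algebra_simps)
    then have "(norm (incr (Suc k) X n))\<^sup>2 \<le> (p + q)\<^sup>2"
      by (intro power_mono) auto
    also have "\<dots> \<le> 2 * p\<^sup>2 + 2 * q\<^sup>2"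
      using sum_squares_bound[of p q] by (simp add: power2_sum)
    finally show ?thesis
      by (simp add: p_def q_def \<kappa>_def power_mult_distrib)
  qed
  have d1: "(norm (incr 1 X n))\<^sup>2 \<le> \<beta>" if "1 \<le> n" "n \<le> N" for n
  proof (cases "n < \<nu>")
    case True
    have "(norm (incr 1 X n))\<^sup>2 \<le> 2 * (norm (X n))\<^sup>2 + 2 * (norm (X (n - 1)))\<^sup>2"
      using power2_norm_diff_le by simp
    also have "\<dots> \<le> 4 * I" using XI[OF True] XI[OF less_imp_diff_less[OF True, of 1]] by simp
    also have "\<dots> \<le> \<beta>" unfolding \<beta>_def using \<kappa> M0 I0 \<rho>0 by simp
    finally show ?thesis .
  next
    case False
    have "(norm (M_AB \<nu> X n))\<^sup>2 \<le> 36 * (\<Sum>j=1..\<nu>. (norm (X (n - j)))\<^sup>2)"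
      by (rule M_AB_power2_norm_le[OF nu])
    also have "(\<Sum>j=1..\<nu>. (norm (X (n - j)))\<^sup>2) \<le> (\<Sum>j=1..\<nu>. M + I)"
      using that by (intro sum_mono XMI) auto
    also have "\<dots> \<le> 4 * (M + I)"
      using mult_right_mono[of "real \<nu>" 4 "M + I"] nu' M0 I0 by simp
    finally have 1: "(norm (M_AB \<nu> X n))\<^sup>2 \<le> 144 * (M + I)" by simp
    have "(norm (R n))\<^sup>2 \<le> (\<Sum>n=\<nu>..N. (norm (R n))\<^sup>2)"
      using that False by (intro member_le_sum) auto
    then have 2: "\<tau>\<^sup>2 * (norm (R n))\<^sup>2 \<le> \<rho>"
      unfolding \<rho>_def by (intro mult_left_mono) auto
    have "(norm (incr 1 X n))\<^sup>2
        \<le> 2 * \<kappa> * (norm (M_AB \<nu> X n))\<^sup>2 + 2 * L\<^sup>2 * (\<tau>\<^sup>2 * (norm (R n))\<^sup>2)"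
      using step2[of 0 n] that False by simp
    also have "\<dots> \<le> 2 * \<kappa> * (144 * (M + I)) + 2 * L\<^sup>2 * \<rho>"
      using 1 2 \<kappa> by (intro add_mono mult_left_mono) auto
    also have "\<dots> \<le> \<beta>" unfolding \<beta>_def using I0 by (simp add: algebra_simps)
    finally show ?thesis .
  qed
  have p4: "(4::real) ^ (\<nu> - 1) \<le> 64"
    using nu by auto
  \<comment> \<open>For \<open>n < 2 * \<nu> - 1\<close> the \<open>\<nu>\<close>-th difference is estimated by first increments, using that there
    are at most three such indices.\<close>
  have early: "a n \<le> 256 * \<beta>" if "\<nu> \<le> n" "n \<le> N" for n
  proof -
    have "incr \<nu> X = incr (\<nu> - 1) (incr 1 X)"
      using incr_Suc_right[of "\<nu> - 1" X] nu' by simp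
    then have "a n \<le> 4 ^ (\<nu> - 1) * (\<Sum>i\<le>\<nu> - 1. (norm (incr 1 X (n - i)))\<^sup>2)"
      unfolding a_def using incr_norm_le by metis
    also have "\<dots> \<le> 64 * (\<Sum>i\<le>\<nu> - 1. (norm (incr 1 X (n - i)))\<^sup>2)"
      using p4 by (intro mult_right_mono sum_nonneg) auto
    also have "(\<Sum>i\<le>\<nu> - 1. (norm (incr 1 X (n - i)))\<^sup>2) \<le> (\<Sum>i\<le>\<nu> - 1. \<beta>)"
      using that nu' by (intro sum_mono d1) auto
    also have "\<dots> \<le> 4 * \<beta>"
      using nu' \<beta>0 by (simp add: mult_right_mono)
    finally show ?thesis by simp
  qed
  \<comment> \<open>The average \<open>M\<close> of differences at \<open>n = 2 * \<nu> - 1\<close> reaches back to \<open>g (\<nu> - 1)\<close>, which is not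
    a term of \<open>J\<close> but involves initial values only.\<close>
  have g0: "g (\<nu> - 1) \<le> 256 * I"
  proof -
    have "g (\<nu> - 1) \<le> 4 ^ (\<nu> - 1) * (\<Sum>i\<le>\<nu> - 1. (norm (X (\<nu> - 1 - i)))\<^sup>2)"
      unfolding g_def by (rule incr_norm_le)
    also have "\<dots> \<le> 64 * (\<Sum>i\<le>\<nu> - 1. (norm (X (\<nu> - 1 - i)))\<^sup>2)"
      using p4 by (intro mult_right_mono sum_nonneg) auto
    also have "(\<Sum>i\<le>\<nu> - 1. (norm (X (\<nu> - 1 - i)))\<^sup>2) \<le> (\<Sum>i\<le>\<nu> - 1. I)"
      using nu' by (intro sum_mono XI) auto
    also have "\<dots> \<le> 4 * I"
      using nu' I0 by (simp add: mult_right_mono)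
    finally show ?thesis by simp
  qed
  have gsum: "(\<Sum>n=\<nu> - 1..m - 1. g n) = g (\<nu> - 1) + J"
  proof -
    have "{\<nu> - 1..m - 1} = insert (\<nu> - 1) {\<nu>..<m}" using m nu' by auto
    then show ?thesis using nu' by (simp add: J_def g_def)
  qed
  have late: "(\<Sum>n=2 * \<nu> - 1..m. a n) \<le> 288 * \<kappa> * (256 * I + J) + 512 * L\<^sup>2 * \<rho>"
  proof -
    have "a n \<le> 72 * \<kappa> * (\<Sum>j=1..\<nu>. g (n - j)) + 128 * L\<^sup>2 * \<tau>\<^sup>2 * (\<Sum>i\<le>\<nu> - 1. r (n - i))"
      if n: "n \<in> {2 * \<nu> - 1..m}" for n
    proof -
      have 1: "(norm (M_AB \<nu> (incr (\<nu> - 1) X) n))\<^sup>2 \<le> 36 * (\<Sum>j=1..\<nu>. g (n - j))"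
        unfolding g_def by (rule M_AB_power2_norm_le[OF nu])
      have "(norm (incr (\<nu> - 1) R n))\<^sup>2 \<le> 4 ^ (\<nu> - 1) * (\<Sum>i\<le>\<nu> - 1. r (n - i))"
        unfolding r_def by (rule incr_norm_le)
      also have "\<dots> \<le> 64 * (\<Sum>i\<le>\<nu> - 1. r (n - i))"
        using p4 by (intro mult_right_mono sum_nonneg) (auto simp: r_def)
      finally have 2: "(norm (incr (\<nu> - 1) R n))\<^sup>2 \<le> 64 * (\<Sum>i\<le>\<nu> - 1. r (n - i))" .
      have "\<nu> + (\<nu> - 1) \<le> n" "n \<le> N" using n m nu' by auto
      then have "a n \<le> 2 * \<kappa> * (norm (M_AB \<nu> (incr (\<nu> - 1) X) n))\<^sup>2
          + 2 * L\<^sup>2 * (\<tau>\<^sup>2 * (norm (incr (\<nu> - 1) R n))\<^sup>2)"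
        using step2[of "\<nu> - 1" n] nu' by (simp add: a_def)
      also have "\<dots> \<le> 2 * \<kappa> * (36 * (\<Sum>j=1..\<nu>. g (n - j)))
          + 2 * L\<^sup>2 * (\<tau>\<^sup>2 * (64 * (\<Sum>i\<le>\<nu> - 1. r (n - i))))"
        using 1 2 \<kappa> by (intro add_mono mult_left_mono) auto
      finally show ?thesis by simp
    qed
    then have "(\<Sum>n=2 * \<nu> - 1..m. a n) \<le> (\<Sum>n=2 * \<nu> - 1..m.
        72 * \<kappa> * (\<Sum>j=1..\<nu>. g (n - j)) + 128 * L\<^sup>2 * \<tau>\<^sup>2 * (\<Sum>i\<le>\<nu> - 1. r (n - i)))"
      by (rule sum_mono)
    also have "\<dots> = 72 * \<kappa> * (\<Sum>n=2 * \<nu> - 1..m. \<Sum>j=1..\<nu>. g (n - j))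
        + 128 * L\<^sup>2 * \<tau>\<^sup>2 * (\<Sum>n=2 * \<nu> - 1..m. \<Sum>i\<le>\<nu> - 1. r (n - i))"
      by (simp add: sum.distrib sum_distrib_left)
    also have "\<dots> \<le> 72 * \<kappa> * (4 * (256 * I + J)) + 128 * L\<^sup>2 * \<tau>\<^sup>2 * (4 * (\<Sum>n=\<nu>..N. r n))"
    proof (intro add_mono mult_left_mono)
      have "(\<Sum>n=2 * \<nu> - 1..m. \<Sum>j=1..\<nu>. g (n - j)) \<le> card {1..\<nu>} * (\<Sum>n=\<nu> - 1..m - 1. g n)"
        by (rule sum_shifts_le) (auto simp: g_def)
      also have "\<dots> \<le> 4 * (256 * I + J)"
        unfolding gsum using nu' g0 J0 I0 by (intro mult_mono) (auto simp: g_def)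
      finally show "(\<Sum>n=2 * \<nu> - 1..m. \<Sum>j=1..\<nu>. g (n - j)) \<le> 4 * (256 * I + J)" .
      have "(\<Sum>n=2 * \<nu> - 1..m. \<Sum>i\<le>\<nu> - 1. r (n - i)) \<le> card {..\<nu> - 1} * (\<Sum>n=\<nu>..N. r n)"
        using m nu' by (intro sum_shifts_le) (auto simp: r_def)
      also have "\<dots> \<le> 4 * (\<Sum>n=\<nu>..N. r n)"
        using nu' by (intro mult_right_mono sum_nonneg) (auto simp: r_def)
      finally show "(\<Sum>n=2 * \<nu> - 1..m. \<Sum>i\<le>\<nu> - 1. r (n - i)) \<le> 4 * (\<Sum>n=\<nu>..N. r n)" .
    qed (use \<kappa> in auto)
    finally show ?thesis by (simp add: \<rho>_def r_def algebra_simps)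
  qed
  have asum: "(\<Sum>n=\<nu>..m. a n) \<le> 768 * \<beta> + 288 * \<kappa> * (256 * I + J) + 512 * L\<^sup>2 * \<rho>"
  proof -
    have "(\<Sum>n=\<nu>..m. a n) = (\<Sum>n\<in>{\<nu>..m} \<inter> {..2 * \<nu> - 2}. a n) + (\<Sum>n=2 * \<nu> - 1..m. a n)"
      using nu' by (subst sum.union_disjoint[symmetric]) (auto intro!: sum.cong)
    also have "(\<Sum>n\<in>{\<nu>..m} \<inter> {..2 * \<nu> - 2}. a n) \<le> (\<Sum>n\<in>{\<nu>..m} \<inter> {..2 * \<nu> - 2}. 256 * \<beta>)"
      using m by (intro sum_mono early) auto
    also have "\<dots> \<le> (\<Sum>n=\<nu>..2 * \<nu> - 2. 256 * \<beta>)"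
      using \<beta>0 by (intro sum_mono2) auto
    also have "\<dots> \<le> 768 * \<beta>"
      using nu \<beta>0 by auto
    finally show ?thesis using late by linarith
  qed
  obtain \<Phi> where \<Phi>: "\<And>n. \<nu> \<le> n \<Longrightarrow>
      (1/2 * (norm (X n))\<^sup>2 + \<Phi> n) - (1/2 * (norm (X (n - 1)))\<^sup>2 + \<Phi> (n - 1))
        + 1/4 * (norm (incr (\<nu> - 1) X (n - 1)))\<^sup>2
      \<le> (X n - X (n - 1)) \<bullet> M_AB \<nu> X n + 1/4 * (norm (incr \<nu> X n))\<^sup>2"
    "\<And>n. \<bar>\<Phi> n\<bar> \<le> 2 * (\<Sum>i<\<nu> - 1. (norm (incr 1 X (n - i)))\<^sup>2)"
    using AB_energy_bound[OF nu] by metis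
  have \<Phi>_le: "\<bar>\<Phi> n\<bar> \<le> 6 * \<beta>" if "\<nu> - 1 \<le> n" "n \<le> N" for n
  proof -
    have "(\<Sum>i<\<nu> - 1. (norm (incr 1 X (n - i)))\<^sup>2) \<le> (\<Sum>i<\<nu> - 1. \<beta>)"
      using that by (intro sum_mono d1) auto
    also have "\<dots> \<le> 3 * \<beta>"
      using nu' \<beta>0 by (simp add: mult_right_mono)
    finally show ?thesis using \<Phi>(2)[of n] by linarith
  qed
  have idx: "\<nu> - 1 \<le> m" "\<nu> - 1 \<le> N" "\<nu> - 1 < \<nu>"
    using m nu' by auto
  define Q where "Q n = 1/2 * (norm (X n))\<^sup>2 + \<Phi> n" for n
  have "(\<Sum>n=\<nu>..m. Q n - Q (n - 1) + 1/4 * g (n - 1))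
      \<le> (\<Sum>n=\<nu>..m. (X n - X (n - 1)) \<bullet> M_AB \<nu> X n + 1/4 * a n)"
    unfolding Q_def g_def a_def by (intro sum_mono \<Phi>(1)) auto
  moreover have "(\<Sum>n=\<nu>..m. Q n - Q (n - 1)) = Q m - Q (\<nu> - 1)"
    using sum_telescope''[of "\<nu> - 1" m Q] m nu' by simp
  moreover have "(\<Sum>n=\<nu>..m. g (n - 1)) = (\<Sum>n=\<nu> - 1..m - 1. g n)"
    using m nu' by (intro sum.reindex_bij_witness[of _ Suc "\<lambda>n. n - 1"]) auto
  moreover note gsum
  ultimately have "Q m - Q (\<nu> - 1) + 1/4 * (g (\<nu> - 1) + J)
      \<le> (\<Sum>n=\<nu>..m. (X n - X (n - 1)) \<bullet> M_AB \<nu> X n) + 1/4 * (\<Sum>n=\<nu>..m. a n)"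
    by (simp add: sum.distrib flip: sum_distrib_left sum_divide_distrib)
  moreover have "1/2 * (norm (X m))\<^sup>2 - 6 * \<beta> \<le> Q m"
    unfolding Q_def using \<Phi>_le[OF idx(1) m(2)] by simp
  moreover have "Q (\<nu> - 1) \<le> I + 6 * \<beta>"
    unfolding Q_def using \<Phi>_le[OF order_refl idx(2)] XI[OF idx(3)] I0 by simp
  moreover have "0 \<le> g (\<nu> - 1)" by (simp add: g_def)
  ultimately have "1/2 * (norm (X m))\<^sup>2 + 1/4 * J
      \<le> (\<Sum>n=\<nu>..m. (X n - X (n - 1)) \<bullet> M_AB \<nu> X n)
        + (204 * \<beta> + I + 72 * \<kappa> * (256 * I + J) + 128 * L\<^sup>2 * \<rho>)"
    using asum by argo
  also have "204 * \<beta> + I + 72 * \<kappa> * (256 * I + J) + 128 * L\<^sup>2 * \<rho>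
      \<le> 60000 * \<kappa> * (M + J) + 80000 * L\<^sup>2 * (I + \<rho>)"
  proof -
    have "\<kappa> * I \<le> I" "I \<le> L\<^sup>2 * I"
      using \<kappa> I0 L2 by (simp_all add: mult_left_le_one_le mult_right_mono[of 1 "L\<^sup>2" I, simplified])
    moreover have "0 \<le> \<kappa> * M" "0 \<le> \<kappa> * J" "0 \<le> L\<^sup>2 * \<rho>"
      using \<kappa> M0 J0 \<rho>0 by auto
    moreover have "\<kappa> * (256 * I) = 256 * (\<kappa> * I)" by simp
    ultimately show ?thesis
      unfolding \<beta>_def ring_distribs mult.assoc using I0 by linarith
  qed
  finally show ?thesis by (simp add: \<kappa>_def)
qed

section \<open>Dependence on the past only\<close>

lemma M_AB_cong: "(\<And>i. i \<le> n \<Longrightarrow> U i = V i) \<Longrightarrow> M_AB \<nu> U n = M_AB \<nu> V n"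
  by (simp add: M_AB_def)

lemma A_op_cong: "(\<And>i. i \<le> n \<Longrightarrow> U i = V i) \<Longrightarrow> A_op \<nu> \<tau> G U n = A_op \<nu> \<tau> G V n"
  using M_AB_cong[of n U V] by (simp add: A_op_def D_tau_def)

lemma P_op_cong: "(\<And>i. i \<le> n \<Longrightarrow> U i = V i) \<Longrightarrow> P_op \<nu> \<delta> \<tau> G U n = P_op \<nu> \<delta> \<tau> G V n"
  using M_AB_cong[of n U V] by (simp add: P_op_def S_op_def D_tau_def)

lemma I_tau_cong: "(\<And>i. i \<le> \<nu> - 1 \<Longrightarrow> U i = V i) \<Longrightarrow> I_tau \<nu> \<delta> G U = I_tau \<nu> \<delta> G V"
  by (simp add: I_tau_def)

lemma E_norm_cong:
  assumes "\<And>i. i \<le> m \<Longrightarrow> U i = V i"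
  shows "E_norm \<nu> \<delta> \<tau> G m U = E_norm \<nu> \<delta> \<tau> G m V"
proof -
  have "(\<Sum>n=\<nu>..m. (norm (A_op \<nu> \<tau> G U n))\<^sup>2) = (\<Sum>n=\<nu>..m. (norm (A_op \<nu> \<tau> G V n))\<^sup>2)"
    using assms by (intro sum.cong refl arg_cong[of _ _ "\<lambda>x. (norm x)\<^sup>2"] A_op_cong) auto
  moreover have "(\<Sum>n=\<nu>..<m. (graph_norm \<delta> G (incr (\<nu> - 1) U n))\<^sup>2)
      = (\<Sum>n=\<nu>..<m. (graph_norm \<delta> G (incr (\<nu> - 1) V n))\<^sup>2)"
    using assms by (intro sum.cong refl arg_cong[of _ _ "\<lambda>x. (graph_norm \<delta> G x)\<^sup>2"] incr_cong) auto
  moreover have "(\<lambda>n. (norm (T_op \<delta> G (U n)))\<^sup>2) ` {\<nu>..m} = (\<lambda>n. (norm (T_op \<delta> G (V n)))\<^sup>2) ` {\<nu>..m}"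
    using assms by (intro image_cong) auto
  ultimately show ?thesis by (simp add: E_norm_def)
qed

section \<open>The scheme for a skew-symmetric operator\<close>

locale skew_operator =
  fixes H :: "'a::real_inner set" and G :: "'a \<Rightarrow> 'a"
  assumes subspace_H: "subspace H"
    and G_add: "U \<in> H \<Longrightarrow> V \<in> H \<Longrightarrow> G (U + V) = G U + G V"
    and G_scaleR: "U \<in> H \<Longrightarrow> G (c *\<^sub>R U) = c *\<^sub>R G U"
    and G_skew: "U \<in> H \<Longrightarrow> V \<in> H \<Longrightarrow> G U \<bullet> V = - (U \<bullet> G V)"
begin

lemma G_diff: "U \<in> H \<Longrightarrow> V \<in> H \<Longrightarrow> G (U - V) = G U - G V"
  using G_add[of U "- V"] G_scaleR[of V "-1"] subspace_neg[OF subspace_H, of V] by simp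

lemma G_sum: "(\<And>i. i \<in> S \<Longrightarrow> f i \<in> H) \<Longrightarrow> G (\<Sum>i\<in>S. f i) = (\<Sum>i\<in>S. G (f i))"
proof (induction S rule: infinite_finite_induct)
  case (insert x F)
  then show ?case by (simp add: G_add subspace_sum[OF subspace_H])
qed (use G_scaleR[of 0 0] subspace_0[OF subspace_H] in auto)

lemma G_skew_same: "U \<in> H \<Longrightarrow> G U \<bullet> U = 0"
  using G_skew[of U U] by (simp add: inner_commute)

lemma M_AB_mem: "(\<And>n. V n \<in> H) \<Longrightarrow> M_AB \<nu> V n \<in> H"
  unfolding M_AB_def by (intro subspace_sum[OF subspace_H] subspace_scale[OF subspace_H])

lemma D_tau_mem: "(\<And>n. V n \<in> H) \<Longrightarrow> D_tau \<tau> V n \<in> H"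
  unfolding D_tau_def by (intro subspace_scale[OF subspace_H] subspace_diff[OF subspace_H])

lemma incr_mem: "(\<And>n. V n \<in> H) \<Longrightarrow> incr k V n \<in> H"
  by (induction k arbitrary: n) (auto intro: subspace_diff[OF subspace_H])

lemma G_M_AB: "(\<And>n. V n \<in> H) \<Longrightarrow> G (M_AB \<nu> V n) = M_AB \<nu> (\<lambda>n. G (V n)) n"
  unfolding M_AB_def by (simp add: G_sum G_scaleR subspace_scale[OF subspace_H])

lemma G_incr: "(\<And>n. V n \<in> H) \<Longrightarrow> G (incr k V n) = incr k (\<lambda>n. G (V n)) n"
  by (induction k arbitrary: n) (auto simp: G_diff incr_mem)

lemma T_incr: "(\<And>n. V n \<in> H) \<Longrightarrow> T_op \<delta> G (incr k V n) = incr k (\<lambda>n. T_op \<delta> G (V n)) n"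
  by (simp add: T_op_def G_incr incr_add incr_scaleR)

lemma T_M_AB: "(\<And>n. V n \<in> H) \<Longrightarrow> T_op \<delta> G (M_AB \<nu> V n) = M_AB \<nu> (\<lambda>n. T_op \<delta> G (V n)) n"
  by (simp add: T_op_def G_M_AB) (simp add: M_AB_def scaleR_add_right sum.distrib scaleR_sum_right mult.commute)

lemma T_add: "U \<in> H \<Longrightarrow> V \<in> H \<Longrightarrow> T_op \<delta> G (U + V) = T_op \<delta> G U + T_op \<delta> G V"
  by (simp add: T_op_def G_add scaleR_add_right)

lemma T_diff: "U \<in> H \<Longrightarrow> V \<in> H \<Longrightarrow> T_op \<delta> G (U - V) = T_op \<delta> G U - T_op \<delta> G V"
  by (simp add: T_op_def G_diff scaleR_diff_right)

lemma T_scaleR: "U \<in> H \<Longrightarrow> T_op \<delta> G (c *\<^sub>R U) = c *\<^sub>R T_op \<delta> G U"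
  by (simp add: T_op_def G_scaleR scaleR_add_right mult.commute)

lemma T_inner_T:
  assumes "U \<in> H" "V \<in> H"
  shows "T_op \<delta> G U \<bullet> T_op \<delta> G V = U \<bullet> V + \<delta>\<^sup>2 * (G U \<bullet> G V)"
  using G_skew[OF assms] by (simp add: T_op_def inner_simps power2_eq_square algebra_simps)

lemma graph_norm_eq: "U \<in> H \<Longrightarrow> graph_norm \<delta> G U = norm (T_op \<delta> G U)"
  using T_inner_T[of U U] by (simp add: graph_norm_def norm_eq_sqrt_inner)

lemma norm_le_T: "U \<in> H \<Longrightarrow> norm U \<le> norm (T_op \<delta> G U)"
  using T_inner_T[of U U \<delta>] by (simp add: norm_le)

text \<open>
  With \<open>d = D\<^sub>\<tau> V\<close> and \<open>m = M V\<close> the argument of \<open>T\<^sub>\<delta>\<close> is \<open>m + \<delta> d\<close>, so the test function is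
  \<open>m + \<delta> (d + G m) + \<delta>\<^sup>2 G d\<close>, whose middle part is \<open>\<delta> A\<^sub>\<tau> V\<close>. Skew-symmetry removes \<open>(G m, m)\<close>
  and \<open>(d, G d)\<close>, and besides \<open>\<delta> \<parallel>A\<^sub>\<tau> V\<parallel>\<^sup>2\<close> the graph inner product of \<open>d\<close> and \<open>m\<close>
  remains.
\<close>

lemma A_inner_P:
  assumes V: "\<And>n. V n \<in> H" and \<tau>: "\<tau> \<noteq> 0"
  shows "\<tau> * (A_op \<nu> \<tau> G V n \<bullet> P_op \<nu> \<delta> \<tau> G V n)
    = (T_op \<delta> G (V n) - T_op \<delta> G (V (n - 1))) \<bullet> M_AB \<nu> (\<lambda>n. T_op \<delta> G (V n)) n
      + \<tau> * \<delta> * (norm (A_op \<nu> \<tau> G V n))\<^sup>2"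
proof -
  define d where "d = D_tau \<tau> V n"
  define m where "m = M_AB \<nu> V n"
  have dm: "d \<in> H" "m \<in> H"
    by (simp_all add: d_def m_def V D_tau_mem M_AB_mem)
  have G: "G (m + \<delta> *\<^sub>R d) = G m + \<delta> *\<^sub>R G d"
    using dm by (simp add: G_add G_scaleR subspace_scale[OF subspace_H])
  have skew: "G d \<bullet> d = 0" "G m \<bullet> m = 0" "G m \<bullet> d = - (m \<bullet> G d)"
    using dm by (auto simp: G_skew_same G_skew)
  have "(d + G m) \<bullet> T_op \<delta> G (m + \<delta> *\<^sub>R d)
      = d \<bullet> m + \<delta>\<^sup>2 * (G d \<bullet> G m) + \<delta> * ((d + G m) \<bullet> (d + G m))"
    using skew unfolding T_op_def G
    by (simp add: inner_simps algebra_simps inner_commute power2_eq_square)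
  also have "d \<bullet> m + \<delta>\<^sup>2 * (G d \<bullet> G m) = T_op \<delta> G d \<bullet> T_op \<delta> G m"
    using dm by (simp add: T_inner_T)
  finally have "\<tau> * ((d + G m) \<bullet> T_op \<delta> G (m + \<delta> *\<^sub>R d))
      = (\<tau> *\<^sub>R T_op \<delta> G d) \<bullet> T_op \<delta> G m + \<tau> * \<delta> * (norm (d + G m))\<^sup>2"
    by (simp add: power2_norm_eq_inner distrib_left mult.assoc)
  moreover have "\<tau> *\<^sub>R T_op \<delta> G d = T_op \<delta> G (V n) - T_op \<delta> G (V (n - 1))"
    using \<tau> V by (simp add: d_def D_tau_def T_scaleR T_diff subspace_diff[OF subspace_H])
  moreover have "T_op \<delta> G m = M_AB \<nu> (\<lambda>n. T_op \<delta> G (V n)) n"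
    by (simp add: m_def T_M_AB V)
  ultimately show ?thesis
    unfolding A_op_def P_op_def S_op_def d_def[symmetric] m_def[symmetric] by (simp only:)
qed

text \<open>
  The residual \<open>u + F\<close> is orthogonal to \<open>T\<^sub>\<delta> W\<close> rather than to \<open>W\<close>. The choice \<open>W = u\<close> still
  works because \<open>(u, T\<^sub>\<delta> u) = \<parallel>u\<parallel>\<^sup>2\<close> by skew-symmetry; one factor \<open>K\<close> comes from
  \<open>\<parallel>T\<^sub>\<delta> u\<parallel>\<close> in the Cauchy-Schwarz inequality and one from passing to the graph norm of \<open>u\<close>.
\<close>

lemma T_norm_le_of_galerkin:
  assumes u: "u \<in> H" and orth: "\<And>W. W \<in> H \<Longrightarrow> (u + F) \<bullet> T_op \<delta> G W = 0"
    and inv: "\<And>W. W \<in> H \<Longrightarrow> norm (T_op \<delta> G W) \<le> K * norm W"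
    and K: "0 \<le> K"
  shows "norm (T_op \<delta> G u) \<le> K\<^sup>2 * norm F"
proof -
  have "(norm u)\<^sup>2 = u \<bullet> T_op \<delta> G u"
    using G_skew_same[OF u] by (simp add: T_op_def inner_simps inner_commute power2_norm_eq_inner)
  also have "\<dots> = - (F \<bullet> T_op \<delta> G u)"
    using orth[OF u] by (simp add: inner_add_left)
  also have "\<dots> \<le> norm F * norm (T_op \<delta> G u)"
    using Cauchy_Schwarz_ineq2[of F "T_op \<delta> G u"] by linarith
  also have "\<dots> \<le> norm F * (K * norm u)"
    using inv[OF u] by (intro mult_left_mono) auto
  finally have "norm u * norm u \<le> (K * norm F) * norm u"
    by (simp add: power2_eq_square mult_ac)
  then have "norm u \<le> K * norm F"
    using K by (cases "norm u = 0") auto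
  then have "norm (T_op \<delta> G u) \<le> K * (K * norm F)"
    using inv[OF u] K by (meson mult_left_mono order_trans)
  then show ?thesis by (simp add: power2_eq_square mult.assoc)
qed

text \<open>
  Differences commute with all operators of the scheme, so \<open>d\<^sup>k V\<close> solves the scheme with right-hand
  side \<open>d\<^sup>k R\<close>, and \<open>\<tau> D\<^sub>\<tau> d\<^sup>k V = d\<^sup>k\<^sup>+\<^sup>1 V\<close>. The factor \<open>\<tau>\<close> turns \<open>G\<close> into an operator of norm at
  most \<open>c\<close>.
\<close>

lemma incr_T_norm_le:
  assumes V: "\<And>n. V n \<in> H" and \<tau>: "0 < \<tau>" and K: "0 \<le> K" 
    and inv: "\<And>W. W \<in> H \<Longrightarrow> norm (T_op \<delta> G W) \<le> K * norm W"
    and cfl: "\<And>W. W \<in> H \<Longrightarrow> \<tau> * norm (G W) \<le> c * norm W" "0 \<le> c"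
    and scheme: "\<And>n W. \<nu> \<le> n \<Longrightarrow> n \<le> N \<Longrightarrow> W \<in> H \<Longrightarrow>
      A_op \<nu> \<tau> G V n \<bullet> T_op \<delta> G W = R n \<bullet> T_op \<delta> G W"
    and n: "\<nu> + k \<le> n" "n \<le> N"
  defines "X \<equiv> \<lambda>n. T_op \<delta> G (V n)"
  shows "norm (incr (Suc k) X n) \<le> K\<^sup>2 * (c * norm (M_AB \<nu> (incr k X) n) + \<tau> * norm (incr k R n))"
proof -
  define Y where "Y = M_AB \<nu> (incr k V) n"
  have Y: "Y \<in> H" unfolding Y_def by (intro M_AB_mem incr_mem V)
  define u where "u = incr k (D_tau \<tau> V) n"
  define F where "F = G Y - incr k R n"
  have uH: "u \<in> H" unfolding u_def by (intro incr_mem D_tau_mem V)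
  have GY: "G Y = incr k (\<lambda>n. G (M_AB \<nu> V n)) n"
    by (simp add: Y_def flip: incr_M_AB G_incr add: V M_AB_mem)
  have uF: "u + F = incr k (\<lambda>n. A_op \<nu> \<tau> G V n - R n) n"
    by (simp add: u_def F_def GY A_op_def incr_diff incr_add)
  have "norm (T_op \<delta> G u) \<le> K\<^sup>2 * norm F"
  proof (rule T_norm_le_of_galerkin[OF uH _ inv K])
    fix W assume W: "W \<in> H"
    show "(u + F) \<bullet> T_op \<delta> G W = 0"
      unfolding uF
      by (rule incr_orthogonal[where a = \<nu> and b = N]) (use scheme W n in \<open>auto simp: inner_diff_left\<close>)
  qed
  then have "\<tau> * norm (T_op \<delta> G u) \<le> K\<^sup>2 * (\<tau> * norm F)"
    using \<tau> by (simp add: mult.left_commute)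
  moreover have "\<tau> * norm (T_op \<delta> G u) = norm (incr (Suc k) X n)"
  proof -
    have "incr (Suc k) X n = T_op \<delta> G (\<tau> *\<^sub>R u)"
      using \<tau> by (simp only: u_def incr_D_tau X_def T_incr[OF V])
    then show ?thesis using \<tau> uH by (simp add: T_scaleR)
  qed
  moreover have "\<tau> * norm F \<le> c * norm (M_AB \<nu> (incr k X) n) + \<tau> * norm (incr k R n)"
  proof -
    have "M_AB \<nu> (incr k X) n = T_op \<delta> G Y"
      by (simp add: Y_def X_def T_M_AB T_incr incr_mem V)
    then have "norm Y \<le> norm (M_AB \<nu> (incr k X) n)"
      using norm_le_T[OF Y] by simp
    then have "\<tau> * norm (G Y) \<le> c * norm (M_AB \<nu> (incr k X) n)"
      using cfl(1)[OF Y] cfl(2) by (meson mult_left_mono order_trans)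
    moreover have "\<tau> * norm F \<le> \<tau> * norm (G Y) + \<tau> * norm (incr k R n)"
      unfolding F_def using \<tau> norm_triangle_ineq4[of "G Y" "incr k R n"]
      by (simp flip: distrib_left)
    ultimately show ?thesis by linarith
  qed
  ultimately show ?thesis
    by (metis mult_left_mono order_trans zero_le_power2)
qed

lemma P_eq: "(\<And>n. V n \<in> H) \<Longrightarrow>
    P_op \<nu> \<delta> \<tau> G V n = M_AB \<nu> (\<lambda>n. T_op \<delta> G (V n)) n + \<delta> *\<^sub>R D_tau \<tau> (\<lambda>n. T_op \<delta> G (V n)) n"
  unfolding P_op_def S_op_def
  by (subst T_add) (auto simp: M_AB_mem D_tau_mem T_M_AB T_scaleR subspace_scale[OF subspace_H]
      D_tau_def T_diff subspace_diff[OF subspace_H])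

lemma P_norm_le:
  assumes nu: "\<nu> \<in> {3, 4}" and V: "\<And>n. V n \<in> H" and \<tau>: "0 < \<tau>" and \<delta>: "0 \<le> \<delta>"
    and s: "\<And>i. i \<le> n \<Longrightarrow> norm (T_op \<delta> G (V i)) \<le> s"
  shows "norm (P_op \<nu> \<delta> \<tau> G V n) \<le> (12 + 2 * \<delta> / \<tau>) * s"
proof -
  define X where "X n = T_op \<delta> G (V n)" for n
  have s': "norm (X i) \<le> s" if "i \<le> n" for i
    using s[OF that] by (simp add: X_def)
  have s0: "0 \<le> s" using s'[of n] norm_ge_zero order_trans by blast
  have "norm (M_AB \<nu> X n) \<le> 3 * (\<Sum>j=1..\<nu>. norm (X (n - j)))"
    by (rule M_AB_norm_le[OF nu])
  also have "(\<Sum>j=1..\<nu>. norm (X (n - j))) \<le> (\<Sum>j=1..\<nu>. s)"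
    by (intro sum_mono s') simp
  also have "\<dots> \<le> 4 * s" using nu s0 by auto
  finally have "norm (M_AB \<nu> X n) \<le> 12 * s" by simp
  moreover have "norm (\<delta> *\<^sub>R D_tau \<tau> X n) \<le> \<delta> / \<tau> * (2 * s)"
  proof -
    have "norm (X n - X (n - 1)) \<le> 2 * s"
      using norm_triangle_ineq4[of "X n" "X (n - 1)"] s'[of n] s'[of "n - 1"] by simp
    then have "\<delta> / \<tau> * norm (X n - X (n - 1)) \<le> \<delta> / \<tau> * (2 * s)"
      using \<tau> \<delta> by (intro mult_left_mono) auto
    then show ?thesis using \<tau> \<delta> by (simp add: D_tau_def)
  qed
  ultimately have "norm (M_AB \<nu> X n + \<delta> *\<^sub>R D_tau \<tau> X n) \<le> 12 * s + \<delta> / \<tau> * (2 * s)"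
    by (intro norm_triangle_le) linarith
  then show ?thesis
    using P_eq[OF V] by (simp add: X_def[abs_def] algebra_simps)
qed

lemma E_norm_power2:
  assumes V: "\<And>n. V n \<in> H" and "\<nu> \<le> m" and "0 \<le> \<tau>" "0 \<le> \<delta>"
  shows "(E_norm \<nu> \<delta> \<tau> G m V)\<^sup>2 = (MAX n\<in>{\<nu>..m}. (norm (T_op \<delta> G (V n)))\<^sup>2)
    + \<tau> * \<delta> * (\<Sum>n=\<nu>..m. (norm (A_op \<nu> \<tau> G V n))\<^sup>2)
    + (\<Sum>n=\<nu>..<m. (norm (incr (\<nu> - 1) (\<lambda>n. T_op \<delta> G (V n)) n))\<^sup>2)"
proof -
  have "0 \<le> (norm (T_op \<delta> G (V m)))\<^sup>2" by simp
  also have "\<dots> \<le> (MAX n\<in>{\<nu>..m}. (norm (T_op \<delta> G (V n)))\<^sup>2)"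
    using assms by (intro Max_ge) auto
  finally show ?thesis
    using assms unfolding E_norm_def
    by (subst real_sqrt_pow2) (auto intro!: add_nonneg_nonneg mult_nonneg_nonneg sum_nonneg
        simp: graph_norm_eq incr_mem T_incr)
qed

lemma E_norm_mono:
  assumes V: "\<And>n. V n \<in> H" and "\<nu> \<le> m" "m \<le> N" and "0 \<le> \<tau>" "0 \<le> \<delta>"
  shows "(E_norm \<nu> \<delta> \<tau> G m V)\<^sup>2 \<le> (E_norm \<nu> \<delta> \<tau> G N V)\<^sup>2"
proof -
  have "\<nu> \<le> N" using assms by simp
  show ?thesis
    unfolding E_norm_power2[OF V \<open>\<nu> \<le> m\<close> \<open>0 \<le> \<tau>\<close> \<open>0 \<le> \<delta>\<close>]
      E_norm_power2[OF V \<open>\<nu> \<le> N\<close> \<open>0 \<le> \<tau>\<close> \<open>0 \<le> \<delta>\<close>]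
    using assms by (intro add_mono Max_mono mult_left_mono sum_mono2 image_mono) auto
qed

lemma norm_T_le_sqrt:
  assumes V: "\<And>n. V n \<in> H" and "\<nu> \<le> m" and "0 \<le> \<tau>" "0 \<le> \<delta>" and i: "i \<le> m"
  shows "norm (T_op \<delta> G (V i)) \<le> sqrt (I_tau \<nu> \<delta> G V + (E_norm \<nu> \<delta> \<tau> G m V)\<^sup>2)"
proof (rule real_le_rsqrt)
  have I0: "0 \<le> I_tau \<nu> \<delta> G V" by (simp add: I_tau_def sum_nonneg)
  show "(norm (T_op \<delta> G (V i)))\<^sup>2 \<le> I_tau \<nu> \<delta> G V + (E_norm \<nu> \<delta> \<tau> G m V)\<^sup>2"
  proof (cases "i < \<nu>")
    case True
    have "(norm (T_op \<delta> G (V i)))\<^sup>2 \<le> I_tau \<nu> \<delta> G V"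
      unfolding I_tau_def using True by (intro member_le_sum) auto
    then show ?thesis by (simp add: add_increasing2)
  next
    case False
    have "(norm (T_op \<delta> G (V i)))\<^sup>2 \<le> (MAX n\<in>{\<nu>..m}. (norm (T_op \<delta> G (V n)))\<^sup>2)"
      using False i by (intro Max_ge) auto
    also have "\<dots> \<le> (E_norm \<nu> \<delta> \<tau> G m V)\<^sup>2"
    proof -
      have "0 \<le> \<tau> * \<delta> * (\<Sum>n=\<nu>..m. (norm (A_op \<nu> \<tau> G V n))\<^sup>2)"
        using assms by (intro mult_nonneg_nonneg sum_nonneg) auto
      moreover have "0 \<le> (\<Sum>n=\<nu>..<m. (norm (incr (\<nu> - 1) (\<lambda>n. T_op \<delta> G (V n)) n))\<^sup>2)"
        by (intro sum_nonneg) auto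
      ultimately show ?thesis
        unfolding E_norm_power2[OF V assms(2-4)] by linarith
    qed
    finally show ?thesis using I0 by simp
  qed
qed

section \<open>The dual norm of the right-hand side\<close>

text \<open>
  The supremum in \<^const>\<open>E_dual_norm\<close> is a supremum of reals, so the inequality needs that it is taken
  over a set that is bounded above. The crude bound \<open>B\<close>, which depends on \<open>R\<close>, \<open>\<tau>\<close> and \<open>\<delta>\<close>, provides
  this and also settles the case of a vanishing denominator. The sequence need not vanish after \<open>m\<close>:
  both sides depend on \<open>V 0, \<dots>, V m\<close> alone, so its truncation is the test sequence.
\<close>

lemma sum_inner_P_le_dual:
  assumes nu: "\<nu> \<in> {3, 4}" and V: "\<And>n. V n \<in> H" and \<tau>: "0 < \<tau>" and \<delta>: "0 \<le> \<delta>"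
    and m: "\<nu> \<le> m" "m \<le> N"
  shows "\<tau> * (\<Sum>n=\<nu>..m. R n \<bullet> P_op \<nu> \<delta> \<tau> G V n)
    \<le> E_dual_norm \<nu> \<delta> \<tau> G H N R * sqrt (I_tau \<nu> \<delta> G V + (E_norm \<nu> \<delta> \<tau> G m V)\<^sup>2)"
proof -
  define s where "s V = sqrt (I_tau \<nu> \<delta> G V + (E_norm \<nu> \<delta> \<tau> G m V)\<^sup>2)" for V
  define f where "f V = \<tau> * (\<Sum>n=\<nu>..m. R n \<bullet> P_op \<nu> \<delta> \<tau> G V n)" for V
  define \<A> where "\<A> = {V. (\<forall>n. V n \<in> H) \<and> (\<forall>n. n \<notin> {0..m} \<longrightarrow> V n = 0) \<and> 0 < s V}"
  define B where "B = \<tau> * (\<Sum>n=\<nu>..m. norm (R n) * (12 + 2 * \<delta> / \<tau>))"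
  have f_le: "f V \<le> B * s V" if V: "\<And>n. V n \<in> H" for V
  proof -
    have "R n \<bullet> P_op \<nu> \<delta> \<tau> G V n \<le> norm (R n) * (12 + 2 * \<delta> / \<tau>) * s V" if "n \<in> {\<nu>..m}" for n
    proof -
      have "norm (P_op \<nu> \<delta> \<tau> G V n) \<le> (12 + 2 * \<delta> / \<tau>) * s V"
        unfolding s_def using that m \<tau> \<delta> by (intro P_norm_le[OF nu V \<tau> \<delta>] norm_T_le_sqrt[OF V]) auto
      then have "norm (R n) * norm (P_op \<nu> \<delta> \<tau> G V n) \<le> norm (R n) * ((12 + 2 * \<delta> / \<tau>) * s V)"
        by (intro mult_left_mono) auto
      then show ?thesis
        using norm_cauchy_schwarz[of "R n" "P_op \<nu> \<delta> \<tau> G V n"] by (simp add: mult.assoc)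
    qed
    then have "(\<Sum>n=\<nu>..m. R n \<bullet> P_op \<nu> \<delta> \<tau> G V n) \<le> (\<Sum>n=\<nu>..m. norm (R n) * (12 + 2 * \<delta> / \<tau>) * s V)"
      by (rule sum_mono)
    then show ?thesis
      unfolding f_def B_def using \<tau> by (simp add: mult.assoc flip: sum_distrib_right)
  qed
  define U where "U n = (if n \<le> m then V n else 0)" for n
  have UV: "i \<le> m \<Longrightarrow> U i = V i" for i by (simp add: U_def)
  have UH: "U n \<in> H" for n using V subspace_0[OF subspace_H] by (simp add: U_def)
  have sU: "s U = s V"
    using E_norm_cong[of m U V] I_tau_cong[of \<nu> U V] UV m by (simp add: s_def)
  have fU: "f U = f V"
    unfolding f_def by (intro arg_cong2[of _ _ _ _ "(*)"] sum.cong refl arg_cong[of _ _ "inner _"] P_op_cong UV) auto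
  have s0: "0 \<le> s V" by (simp add: s_def I_tau_def sum_nonneg)
  show ?thesis
  proof (cases "s V = 0")
    case True
    then show ?thesis using f_le[of V, OF V] by (simp add: f_def s_def)
  next
    case False
    have UA: "U \<in> \<A>"
      using UH False s0 sU by (auto simp: \<A>_def U_def)
    have bdd: "bdd_above ((\<lambda>V. f V / s V) ` \<A>)"
      using f_le by (intro bdd_aboveI2[of _ _ B]) (auto simp: \<A>_def divide_le_eq)
    have "f U / s U \<le> (SUP V\<in>\<A>. f V / s V)"
      by (rule cSUP_upper[OF UA bdd])
    also have "\<dots> \<le> E_dual_norm \<nu> \<delta> \<tau> G H N R"
      unfolding E_dual_norm_def f_def s_def \<A>_def using m by (intro Max_ge) auto
    finally have "f V / s V \<le> E_dual_norm \<nu> \<delta> \<tau> G H N R" by (simp add: sU fU)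
    then show ?thesis
      using False s0 by (simp add: divide_le_eq f_def s_def)
  qed
qed

section \<open>Stability\<close>

text \<open>
  No Gronwall argument enters: the energy estimate holds at every \<open>m\<close> with the same right-hand side,
  which consists of data, of \<open>D * s\<close> and of a small multiple of the full norm \<open>E\<close>. It is
  used twice, at an index where the maximum in \<open>E\<close> is attained and at the last index, which controls
  the two sums in \<open>E\<close>.
\<close>

lemma AB_stability:
  assumes nu: "\<nu> \<in> {3, 4}" and V: "\<And>n. V n \<in> H" and \<tau>: "0 < \<tau>" and \<delta>: "0 \<le> \<delta>"
    and K: "1 \<le> K" and inv: "\<And>W. W \<in> H \<Longrightarrow> norm (T_op \<delta> G W) \<le> K * norm W"
    and c: "0 \<le> c" "K\<^sup>2 * c \<le> 1/1000"
    and cfl: "\<And>W. W \<in> H \<Longrightarrow> \<tau> * norm (G W) \<le> c * norm W"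
    and N: "\<nu> \<le> N"
    and scheme: "\<And>n W. \<nu> \<le> n \<Longrightarrow> n \<le> N \<Longrightarrow> W \<in> H \<Longrightarrow>
      A_op \<nu> \<tau> G V n \<bullet> T_op \<delta> G W = R n \<bullet> T_op \<delta> G W"
  shows "(E_norm \<nu> \<delta> \<tau> G N V)\<^sup>2 \<le> 2000000 * (K\<^sup>2)\<^sup>2 *
    (I_tau \<nu> \<delta> G V + (E_dual_norm \<nu> \<delta> \<tau> G H N R)\<^sup>2 + \<tau> * (l2_norm \<tau> \<nu> N R)\<^sup>2)"
proof -
  define X where "X n = T_op \<delta> G (V n)" for n
  define I where "I = I_tau \<nu> \<delta> G V"
  define D where "D = \<bar>E_dual_norm \<nu> \<delta> \<tau> G H N R\<bar>"
  define \<rho> where "\<rho> = \<tau>\<^sup>2 * (\<Sum>n=\<nu>..N. (norm (R n))\<^sup>2)"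
  define M where "M = (MAX n\<in>{\<nu>..N}. (norm (X n))\<^sup>2)"
  define a where "a m = \<tau> * \<delta> * (\<Sum>n=\<nu>..m. (norm (A_op \<nu> \<tau> G V n))\<^sup>2)" for m
  define J where "J m = (\<Sum>n=\<nu>..<m. (norm (incr (\<nu> - 1) X n))\<^sup>2)" for m
  define E where "E = (E_norm \<nu> \<delta> \<tau> G N V)\<^sup>2"
  define s where "s = sqrt (I + E)"
  define \<kappa> where "\<kappa> = (K\<^sup>2 * c)\<^sup>2"
  have E: "E = M + a N + J N"
    unfolding E_def M_def a_def J_def X_def[abs_def] using \<tau> \<delta> N by (simp add: E_norm_power2 V)
  have M: "(norm (X n))\<^sup>2 \<le> M" if "\<nu> \<le> n" "n \<le> N" for n
    unfolding M_def using that by (intro Max_ge) auto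
  have M0: "0 \<le> M" using M[of N] N zero_le_power2 order_trans by blast
  have I0: "0 \<le> I" and J0: "0 \<le> J m" and a0: "0 \<le> a m" and \<rho>0: "0 \<le> \<rho>" for m
    using \<tau> \<delta> by (auto simp: I_def I_tau_def J_def a_def \<rho>_def sum_nonneg)
  have E0: "0 \<le> E" by (simp add: E_def)
  have s2: "s\<^sup>2 = I + E" and s0: "0 \<le> s" using I0 E0 by (auto simp: s_def)
  have K2: "1 \<le> K\<^sup>2" using K by (simp add: one_le_power)
  have "\<kappa> \<le> (1/1000)\<^sup>2"
    unfolding \<kappa>_def using c by (intro power_mono) auto
  also have "(1/1000 :: real)\<^sup>2 = 1/1000000"
    by (simp add: power2_eq_square)
  finally have \<kappa>: "0 \<le> \<kappa>" "60000 * \<kappa> \<le> 6/100"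
    by (simp_all add: \<kappa>_def)
  have est: "1/2 * (norm (X m))\<^sup>2 + a m + 1/4 * J m
      \<le> D * s + 6/100 * E + 80000 * (K\<^sup>2)\<^sup>2 * (I + \<rho>)" if m: "\<nu> \<le> m" "m \<le> N" for m
  proof -
    have "a m + (\<Sum>n=\<nu>..m. (X n - X (n - 1)) \<bullet> M_AB \<nu> X n)
        = (\<Sum>n=\<nu>..m. \<tau> * (A_op \<nu> \<tau> G V n \<bullet> P_op \<nu> \<delta> \<tau> G V n))"
      using \<tau> by (subst A_inner_P) (auto simp: V a_def X_def[abs_def] sum.distrib sum_distrib_left)
    also have "\<dots> = \<tau> * (\<Sum>n=\<nu>..m. R n \<bullet> P_op \<nu> \<delta> \<tau> G V n)"
      unfolding sum_distrib_left P_op_def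
      using m scheme V by (intro sum.cong arg_cong[of _ _ "\<lambda>x. \<tau> * x"] scheme)
        (auto simp: S_op_def intro!: subspace_add[OF subspace_H] subspace_scale[OF subspace_H] M_AB_mem D_tau_mem)
    also have "\<dots> \<le> E_dual_norm \<nu> \<delta> \<tau> G H N R * sqrt (I + (E_norm \<nu> \<delta> \<tau> G m V)\<^sup>2)"
      unfolding I_def by (rule sum_inner_P_le_dual[OF nu V \<tau> \<delta> m])
    also have "\<dots> \<le> D * sqrt (I + (E_norm \<nu> \<delta> \<tau> G m V)\<^sup>2)"
      unfolding D_def using I0 by (intro mult_right_mono) auto
    also have "\<dots> \<le> D * s"
      unfolding s_def E_def D_def using \<tau> \<delta> m V by (intro mult_left_mono) (auto intro!: E_norm_mono)
    finally have energy: "a m + (\<Sum>n=\<nu>..m. (X n - X (n - 1)) \<bullet> M_AB \<nu> X n) \<le> D * s" .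
    have "1/2 * (norm (X m))\<^sup>2 + 1/4 * J m
        \<le> (\<Sum>n=\<nu>..m. (X n - X (n - 1)) \<bullet> M_AB \<nu> X n) + 60000 * \<kappa> * (M + J m)
          + 80000 * (K\<^sup>2)\<^sup>2 * (I + \<rho>)"
      unfolding J_def \<kappa>_def \<rho>_def I_def I_tau_def X_def[symmetric]
    proof (rule AB_coercivity[OF nu K2 c(1) _ _ _ M m])
      show "K\<^sup>2 * c \<le> 1" using c by simp
      show "norm (incr (Suc k) X n) \<le> K\<^sup>2 * (c * norm (M_AB \<nu> (incr k X) n) + \<tau> * norm (incr k R n))"
        if "\<nu> + k \<le> n" "n \<le> N" for k n
        unfolding X_def[abs_def] using K that
        by (intro incr_T_norm_le[OF V \<tau> _ inv cfl c(1) scheme]) auto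
    qed (use \<tau> in auto)
    moreover have "60000 * \<kappa> * (M + J m) \<le> 6/100 * E"
    proof (rule mult_mono)
      have "J m \<le> J N" unfolding J_def using m by (intro sum_mono2) auto
      then show "M + J m \<le> E" using a0[of N] by (simp add: E)
    qed (use \<kappa> M0 J0 in auto)
    ultimately show ?thesis using energy by linarith
  qed
  \<comment> \<open>\<open>est\<close> at this \<open>k\<close> controls \<open>M\<close>, and at \<open>N\<close> it controls \<open>a N + J N\<close>.\<close>
  have "M \<in> (\<lambda>n. (norm (X n))\<^sup>2) ` {\<nu>..N}"
    unfolding M_def using N by (intro Max_in) auto
  then obtain k where k: "\<nu> \<le> k" "k \<le> N" "(norm (X k))\<^sup>2 = M" by auto
  have "1/4 * E \<le> 2 * (D * s) + 12/100 * E + 160000 * (K\<^sup>2)\<^sup>2 * (I + \<rho>)"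
    using est[OF k(1,2)] est[OF N order_refl] a0[of k] a0[of N] J0[of k] M0
      zero_le_power2[of "norm (X N)"] k(3) unfolding E by argo
  \<comment> \<open>Young's inequality, with a weight small enough for \<open>E\<close> to be absorbed on the left.\<close>
  moreover have "2 * (D * s) \<le> 3/100 * (I + E) + 100/3 * D\<^sup>2"
  proof -
    have "0 \<le> 3/100 * (s - 100/3 * D)\<^sup>2" by simp
    then show ?thesis unfolding s2[symmetric] by (simp add: power2_eq_square algebra_simps)
  qed
  moreover have "I \<le> (K\<^sup>2)\<^sup>2 * I" "D\<^sup>2 \<le> (K\<^sup>2)\<^sup>2 * D\<^sup>2"
    using mult_right_mono[OF one_le_power[OF K2, of 2] I0]
      mult_right_mono[OF one_le_power[OF K2, of 2], of "D\<^sup>2"] by simp_all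
  moreover have "0 \<le> (K\<^sup>2)\<^sup>2 * \<rho>" "0 \<le> (K\<^sup>2)\<^sup>2 * I" "0 \<le> (K\<^sup>2)\<^sup>2 * D\<^sup>2" using \<rho>0 I0 by auto
  ultimately have "E \<le> 2000000 * ((K\<^sup>2)\<^sup>2 * I + (K\<^sup>2)\<^sup>2 * D\<^sup>2 + (K\<^sup>2)\<^sup>2 * \<rho>)"
    unfolding ring_distribs mult.assoc by argo
  moreover have "\<tau> * (l2_norm \<tau> \<nu> N R)\<^sup>2 = \<rho>"
    using \<tau> by (simp add: l2_norm_def \<rho>_def power2_eq_square sum_nonneg mult.assoc)
  ultimately show ?thesis
    by (simp add: E_def I_def D_def ring_distribs mult.assoc)
qed

end

theorem theorem6p1:
  fixes \<V> :: "'a::{real_inner, complete_space} set"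
    and G :: "'a \<Rightarrow> 'a"
    and \<nu> :: nat
    and C\<^sub>G C\<^sub>\<delta> T :: real
  assumes "subspace \<V>" and "closure \<V> = UNIV"
    and "\<And>U V. U \<in> \<V> \<Longrightarrow> V \<in> \<V> \<Longrightarrow> G (U + V) = G U + G V"
    and "\<And>c U. U \<in> \<V> \<Longrightarrow> G (c *\<^sub>R U) = c *\<^sub>R G U"
    and "\<And>U V. U \<in> \<V> \<Longrightarrow> V \<in> \<V> \<Longrightarrow> G U \<bullet> V = - (U \<bullet> G V)"
    and "\<nu> \<in> {3, 4}"
    and "0 < C\<^sub>G" and "0 < C\<^sub>\<delta>"
  shows "\<exists>c\<^sub>0>0. \<exists>C>0. \<forall>c\<^sub>A\<^sub>B (\<V>\<^sub>h :: 'a set) h \<delta> \<tau> (N::nat) (V :: nat \<Rightarrow> 'a) (R :: nat \<Rightarrow> 'a).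
    0 < c\<^sub>A\<^sub>B \<and> c\<^sub>A\<^sub>B \<le> c\<^sub>0
    \<and> subspace \<V>\<^sub>h \<and> (\<exists>B. finite B \<and> span B = \<V>\<^sub>h) \<and> \<V>\<^sub>h \<subseteq> \<V>
    \<and> 0 < h \<and> (\<forall>W\<in>\<V>\<^sub>h. norm (G W) \<le> C\<^sub>G * inverse h * norm W)
    \<and> 0 < \<delta> \<and> \<delta> \<le> C\<^sub>\<delta> * h
    \<and> 0 < \<tau> \<and> \<tau> \<le> c\<^sub>A\<^sub>B * inverse C\<^sub>G * h
    \<and> \<nu> \<le> N \<and> real N * \<tau> \<le> T
    \<and> (\<forall>n\<le>N. V n \<in> \<V>\<^sub>h)
    \<and> (\<forall>n\<in>{\<nu>..N}. \<forall>W\<in>\<V>\<^sub>h. A_op \<nu> \<tau> G V n \<bullet> T_op \<delta> G W = R n \<bullet> T_op \<delta> G W)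
    \<longrightarrow> (E_norm \<nu> \<delta> \<tau> G N V)\<^sup>2
          \<le> C * (I_tau \<nu> \<delta> G V + (E_dual_norm \<nu> \<delta> \<tau> G \<V>\<^sub>h N R)\<^sup>2 + \<tau> * (l2_norm \<tau> \<nu> N R)\<^sup>2)"
proof -
  \<comment> \<open>A bound for \<open>T\<^sub>\<delta>\<close> on the discrete space: \<open>\<delta> C\<^sub>G / h \<le> C\<^sub>\<delta> C\<^sub>G\<close>.\<close>
  define K where "K = 1 + C\<^sub>\<delta> * C\<^sub>G"
  have K: "1 \<le> K" using assms(7,8) by (simp add: K_def)
  define c\<^sub>0 where "c\<^sub>0 = 1 / (1000 * K\<^sup>2)"
  define C where "C = 2000000 * (K\<^sup>2)\<^sup>2"
  have pos: "0 < c\<^sub>0" "0 < C" using K by (auto simp: c\<^sub>0_def C_def)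
  have bound: "(E_norm \<nu> \<delta> \<tau> G N V)\<^sup>2
      \<le> C * (I_tau \<nu> \<delta> G V + (E_dual_norm \<nu> \<delta> \<tau> G \<V>\<^sub>h N R)\<^sup>2 + \<tau> * (l2_norm \<tau> \<nu> N R)\<^sup>2)"
    if c: "0 < c" "c \<le> c\<^sub>0" and sub: "subspace \<V>\<^sub>h" "\<V>\<^sub>h \<subseteq> \<V>" and h: "0 < h"
      and inv: "\<And>W. W \<in> \<V>\<^sub>h \<Longrightarrow> norm (G W) \<le> C\<^sub>G * inverse h * norm W"
      and \<delta>: "0 < \<delta>" "\<delta> \<le> C\<^sub>\<delta> * h" and \<tau>: "0 < \<tau>" "\<tau> \<le> c * inverse C\<^sub>G * h" and N: "\<nu> \<le> N"
      and V: "\<And>n. n \<le> N \<Longrightarrow> V n \<in> \<V>\<^sub>h"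
      and scheme: "\<And>n W. \<nu> \<le> n \<Longrightarrow> n \<le> N \<Longrightarrow> W \<in> \<V>\<^sub>h \<Longrightarrow>
        A_op \<nu> \<tau> G V n \<bullet> T_op \<delta> G W = R n \<bullet> T_op \<delta> G W"
    for c \<V>\<^sub>h h \<delta> \<tau> N and V R :: "nat \<Rightarrow> 'a"
  proof -
    interpret skew_operator \<V>\<^sub>h G
      by unfold_locales (auto intro!: assms(3-5) subsetD[OF sub(2)] sub(1))
    \<comment> \<open>The values of \<open>V\<close> beyond \<open>N\<close> are arbitrary; setting them to zero gives a sequence in the
      subspace.\<close>
    define U where "U n = (if n \<le> N then V n else 0)" for n
    have UH: "U n \<in> \<V>\<^sub>h" for n using V subspace_0[OF sub(1)] by (simp add: U_def)
    have UV: "i \<le> N \<Longrightarrow> U i = V i" for i by (simp add: U_def)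
    have T: "norm (T_op \<delta> G W) \<le> K * norm W" if W: "W \<in> \<V>\<^sub>h" for W
    proof -
      have "\<delta> * norm (G W) \<le> (C\<^sub>\<delta> * h) * (C\<^sub>G * inverse h * norm W)"
        using \<delta> inv[OF W] assms(8) h by (intro mult_mono) auto
      also have "\<dots> = C\<^sub>\<delta> * C\<^sub>G * norm W" using h by (simp add: field_simps)
      finally have "norm (\<delta> *\<^sub>R G W) \<le> C\<^sub>\<delta> * C\<^sub>G * norm W" using \<delta> by simp
      then have "norm (W + \<delta> *\<^sub>R G W) \<le> norm W + C\<^sub>\<delta> * C\<^sub>G * norm W"
        by (intro norm_triangle_le) simp
      then show ?thesis by (simp add: T_op_def K_def ring_distribs)
    qed
    have cfl: "\<tau> * norm (G W) \<le> c * norm W" if W: "W \<in> \<V>\<^sub>h" for W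
    proof -
      have "\<tau> * norm (G W) \<le> (c * inverse C\<^sub>G * h) * (C\<^sub>G * inverse h * norm W)"
        using \<tau> inv[OF W] assms(7) h c by (intro mult_mono) auto
      also have "\<dots> = c * norm W" using h assms(7) by (simp add: field_simps)
      finally show ?thesis .
    qed
    have "K\<^sup>2 * c \<le> K\<^sup>2 * c\<^sub>0" using c by (intro mult_left_mono) auto
    also have "\<dots> = 1/1000" using K by (simp add: c\<^sub>0_def)
    finally have Kc: "K\<^sup>2 * c \<le> 1/1000" .
    have "(E_norm \<nu> \<delta> \<tau> G N U)\<^sup>2
        \<le> C * (I_tau \<nu> \<delta> G U + (E_dual_norm \<nu> \<delta> \<tau> G \<V>\<^sub>h N R)\<^sup>2 + \<tau> * (l2_norm \<tau> \<nu> N R)\<^sup>2)"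
      unfolding C_def
    proof (rule AB_stability[OF assms(6) UH \<tau>(1) _ K T _ Kc cfl N])
      fix n W assume "\<nu> \<le> n" "n \<le> N" "W \<in> \<V>\<^sub>h"
      moreover from \<open>n \<le> N\<close> have "A_op \<nu> \<tau> G U n = A_op \<nu> \<tau> G V n"
        by (intro A_op_cong UV) simp
      ultimately show "A_op \<nu> \<tau> G U n \<bullet> T_op \<delta> G W = R n \<bullet> T_op \<delta> G W"
        using scheme by simp
    qed (use \<delta> c in auto)
    moreover have "E_norm \<nu> \<delta> \<tau> G N U = E_norm \<nu> \<delta> \<tau> G N V"
      by (intro E_norm_cong UV)
    moreover have "I_tau \<nu> \<delta> G U = I_tau \<nu> \<delta> G V"
      using N by (intro I_tau_cong UV) simp
    ultimately show ?thesis by simp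
  qed
  show ?thesis
    by (rule exI[of _ c\<^sub>0], rule conjI, fact, rule exI[of _ C], rule conjI, fact)
      (intro allI impI, elim conjE, rule bound, auto)
qed

end
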